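(* Let $F$ be a topological field that is complete (with respect to its additive group uniformity) and satisfies the Stone-Weierstrass theorem. Then the category $\mathsf{KH}_F$ of compact $F$-Tychonoff spaces and continuous maps is dual (contravariantly equivalent) to the category of $F$-algebras $A$ and unital $F$-algebra morphisms such that: (i) $A$ is Gelfand; (ii) $A$ is semisimple; (iii) the spectrum $\sigma(a)$ of every $a\in A$ is compact; (iv) every prime ideal of $A$ is contained in a unique maximal ideal; and $A$ is complete with respect to its canonical uniformity.
   Context: Topological fields have continuous addition, multiplication and inversion and are proper (not indiscrete), hence Hausdorff. $F$-algebras are commutative and unital. A space $X$ is $F$-Tychonoff if it is $T_1$ and for every closed $C\subset X$ and $x\in X\setminus C$ there is a continuous $f:X\to F$ with $f(x)=1$ and $f|_C=0$. $C(X,F)$ is the $F$-algebra of continuous functions $X\to F$. $\mathrm{Max}(A)$ is the set of maximal ideals of $A$. $A$ is Gelfand if for every $M\in\mathrm{Max}(A)$ the canonical map $F\to A/M$ is an isomorphism (so $a+M$ is regarded as an element of $F$). $A$ is semisimple if $\bigcap_{M\in\mathrm{Max}(A)}M=\{0\}$. The spectrum is $\sigma(a)=\{\lambda\in F: a-\lambda\cdot1\text{ is not invertible}\}$. The canonical uniformity on a Gelfand algebra $A$ has basic entourages $V_U=\{(a,b)\in A\times A:(b-a)+M\in U\ \forall M\in\mathrm{Max}(A)\}=\{(a,b):\sigma(b-a)\subset U\}$, with $U$ ranging over a base of symmetric open neighborhoods of $0$ in $F$. A topological field $F$ different from $\mathbb{C}$ is said to satisfy the Stone-Weierstrass theorem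 if for every compact Hausdorff space $X$, every $F$-subalgebra of $C(X,F)$ that contains the constant functions and separates points is dense in $C(X,F)$ for the topology of the canonical uniformity (equivalently, of uniform convergence). In the case $F=\mathbb{C}$ the subalgebra is additionally required to be closed under complex conjugation; in this sense both $\mathbb{R}$ and $\mathbb{C}$ satisfy the Stone-Weierstrass theorem.
   Formalization: When F is (isomorphic to) C, the algebras A are additionally required to have their induced functions M ↦ a+M closed under complex conjugation; without this the claim fails for F = C (McKissick's normal algebra R(K)). Other F are unaffected. *)

theory Defs
  imports
    "HOL-Analysis.Analysis"
    "HOL-Algebra.Algebraic_Closure_Type"
begin

section \<open>Topological fields\<close>

class topological_field = field + topological_ab_group_add + topological_semigroup_mult +
  assumes tendsto_inverse_nhds: "a \<noteq> 0 \<Longrightarrow> filterlim inverse (nhds (inverse a)) (nhds a)"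
    and not_indiscrete: "\<exists>U. open U \<and> U \<noteq> {} \<and> U \<noteq> UNIV"

text \<open>Completeness of a subset \<open>S\<close> with respect to a uniformity that is not given by the
  type class of uniform spaces but as an explicit filter of entourages on pairs; it mirrors
  the library's characterization of \<open>complete\<close>.  The filter \<open>\<F>\<close> on \<open>S\<close> converges to \<open>x\<close> iff the
  sections at \<open>x\<close> of all entourages belong to \<open>\<F>\<close>.\<close>

definition complete_wrt :: "('a \<times> 'a) filter \<Rightarrow> 'a set \<Rightarrow> bool" where
  "complete_wrt \<U> S \<longleftrightarrow>
     (\<forall>\<F> \<le> principal S. \<F> \<noteq> bot \<longrightarrow> \<F> \<times>\<^sub>F \<F> \<le> \<U> \<longrightarrow>
        (\<exists>x\<in>S. \<forall>P. eventually P \<U> \<longrightarrow> eventually (\<lambda>y. P (x, y)) \<F>))"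

definition symmetric_nbhds_0 :: "'f::topological_field set set" where
  "symmetric_nbhds_0 = {U. open U \<and> 0 \<in> U \<and> uminus ` U = U}"

definition additive_uniformity :: "('f::topological_field \<times> 'f) filter" where
  "additive_uniformity = (INF U\<in>symmetric_nbhds_0. principal {(x, y). y - x \<in> U})"

definition complete_field :: "'f::topological_field itself \<Rightarrow> bool" where
  "complete_field _ \<longleftrightarrow> complete_wrt (additive_uniformity :: ('f \<times> 'f) filter) UNIV"

text \<open>Identifications of \<open>'f\<close> with the topological field of complex numbers.  There are either
  none or exactly two of them, and the latter differ by complex conjugation; hence they all
  transport complex conjugation to the same map on \<open>'f\<close>.\<close>

definition complex_identification :: "('f::topological_field \<Rightarrow> complex) \<Rightarrow> bool" where
  "complex_identification \<phi> \<longleftrightarrow>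
     bij \<phi> \<and> (\<forall>x y. \<phi> (x + y) = \<phi> x + \<phi> y) \<and> (\<forall>x y. \<phi> (x * y) = \<phi> x * \<phi> y) \<and>
     continuous_on UNIV \<phi> \<and> continuous_on UNIV (inv_into UNIV \<phi>)"

section \<open>Compact Tychonoff spaces over a topological field\<close>

text \<open>Spaces are called \<open>S\<close>, \<open>T\<close>, \<open>W\<close>, as \<open>X\<close> is notation for polynomial variables in HOL-Algebra.\<close>

definition F_Tychonoff :: "'f::topological_field itself \<Rightarrow> 'x topology \<Rightarrow> bool" where
  "F_Tychonoff _ S \<longleftrightarrow> t1_space S \<and>
     (\<forall>C x. closedin S C \<and> x \<in> topspace S - C \<longrightarrow>
        (\<exists>f :: 'x \<Rightarrow> 'f. continuous_map S euclidean f \<and> f x = 1 \<and> (\<forall>c\<in>C. f c = 0)))"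

definition KH_obj :: "'f::topological_field itself \<Rightarrow> 'x topology \<Rightarrow> bool" where
  "KH_obj F S \<longleftrightarrow> compact_space S \<and> F_Tychonoff F S"

text \<open>Morphisms are normalized to be \<open>undefined\<close> outside their domain, so that equality of
  functions is equality of morphisms.\<close>

definition KH_hom :: "'x topology \<Rightarrow> 'y topology \<Rightarrow> ('x \<Rightarrow> 'y) set" where
  "KH_hom S T = {f \<in> extensional (topspace S). continuous_map S T f}"

definition KH_id :: "'x topology \<Rightarrow> 'x \<Rightarrow> 'x" where
  "KH_id S = (\<lambda>x\<in>topspace S. x)"

definition KH_comp :: "'x topology \<Rightarrow> ('y \<Rightarrow> 'z) \<Rightarrow> ('x \<Rightarrow> 'y) \<Rightarrow> 'x \<Rightarrow> 'z" where
  "KH_comp S g f = compose (topspace S) g f"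

definition KH_iso :: "'x topology \<Rightarrow> 'y topology \<Rightarrow> ('x \<Rightarrow> 'y) set" where
  "KH_iso S T = {f \<in> KH_hom S T. homeomorphic_map S T f}"

section \<open>Algebras over a topological field\<close>

abbreviation scalars :: "'f::topological_field ring" where
  "scalars \<equiv> ring_of_type_algebra"

text \<open>The qualified name is needed because \<open>algebra\<close> alone is an algebra of sets in
  \<^theory>\<open>HOL-Analysis.Sigma_Algebra\<close>.\<close>

definition F_algebra :: "('f::topological_field, 'a) module \<Rightarrow> bool" where
  "F_algebra A \<longleftrightarrow> Module.algebra scalars A"

definition F_subalgebra :: "'a set \<Rightarrow> ('f::topological_field, 'a) module \<Rightarrow> bool" where
  "F_subalgebra B A \<longleftrightarrow> submodule B scalars A \<and> subring B A"

definition GA_hom ::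
    "('f::topological_field, 'a) module \<Rightarrow> ('f, 'b) module \<Rightarrow> ('a \<Rightarrow> 'b) set" where
  "GA_hom A B = {h \<in> extensional (carrier A). h \<in> ring_hom A B \<and>
     (\<forall>k. \<forall>a\<in>carrier A. h (k \<odot>\<^bsub>A\<^esub> a) = k \<odot>\<^bsub>B\<^esub> h a)}"

definition GA_id :: "('f::topological_field, 'a) module \<Rightarrow> 'a \<Rightarrow> 'a" where
  "GA_id A = (\<lambda>a\<in>carrier A. a)"

definition GA_comp ::
    "('f::topological_field, 'a) module \<Rightarrow> ('b \<Rightarrow> 'c) \<Rightarrow> ('a \<Rightarrow> 'b) \<Rightarrow> 'a \<Rightarrow> 'c" where
  "GA_comp A k h = compose (carrier A) k h"

definition GA_iso ::
    "('f::topological_field, 'a) module \<Rightarrow> ('f, 'b) module \<Rightarrow> ('a \<Rightarrow> 'b) set" where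
  "GA_iso A B = GA_hom A B \<inter> ring_iso A B"

definition maximal_ideals :: "('f::topological_field, 'a) module \<Rightarrow> 'a set set" where
  "maximal_ideals A = {M. maximalideal M A}"

definition scalar :: "('f::topological_field, 'a) module \<Rightarrow> 'f \<Rightarrow> 'a" where
  "scalar A k = k \<odot>\<^bsub>A\<^esub> \<one>\<^bsub>A\<^esub>"

definition canonical_map :: "('f::topological_field, 'a) module \<Rightarrow> 'a set \<Rightarrow> 'f \<Rightarrow> 'a set" where
  "canonical_map A M k = M +>\<^bsub>A\<^esub> scalar A k"

definition gelfand :: "('f::topological_field, 'a) module \<Rightarrow> bool" where
  "gelfand A \<longleftrightarrow> (\<forall>M\<in>maximal_ideals A. canonical_map A M \<in> ring_iso scalars (A Quot M))"

text \<open>The coset \<open>a + M\<close> regarded as an element of the field; meaningful for Gelfand algebras.\<close>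

definition residue_value :: "('f::topological_field, 'a) module \<Rightarrow> 'a set \<Rightarrow> 'a \<Rightarrow> 'f" where
  "residue_value A M a = the_inv (canonical_map A M) (M +>\<^bsub>A\<^esub> a)"

definition semisimple :: "('f::topological_field, 'a) module \<Rightarrow> bool" where
  "semisimple A \<longleftrightarrow> {a \<in> carrier A. \<forall>M\<in>maximal_ideals A. a \<in> M} = {\<zero>\<^bsub>A\<^esub>}"

definition spectrum :: "('f::topological_field, 'a) module \<Rightarrow> 'a \<Rightarrow> 'f set" where
  "spectrum A a = {k. a \<ominus>\<^bsub>A\<^esub> scalar A k \<notin> Units A}"

definition canonical_uniformity :: "('f::topological_field, 'a) module \<Rightarrow> ('a \<times> 'a) filter" where
  "canonical_uniformity A = (INF U\<in>symmetric_nbhds_0. principal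
     {(a, b). a \<in> carrier A \<and> b \<in> carrier A \<and> (\<forall>M\<in>maximal_ideals A. residue_value A M (b \<ominus>\<^bsub>A\<^esub> a) \<in> U)})"

text \<open>The counterpart for abstract algebras of the conjugation clause of the Stone-Weierstrass
  theorem: it is void unless the field is the field of complex numbers, and then it says that
  the functions on the maximal ideal space induced by elements of the algebra are closed under
  complex conjugation.  It cannot be omitted there: McKissick's nontrivial normal uniform
  algebra \<open>R(K)\<close> on a Swiss cheese \<open>K\<close> is Gelfand, semisimple and complete, has compact spectra,
  and each of its prime ideals lies in a unique maximal ideal (normality gives, for distinct
  maximal ideals \<open>M\<close> and \<open>N\<close>, some \<open>a \<notin> M\<close> and \<open>b \<notin> N\<close> with \<open>a b = 0\<close>), but it is not
  isomorphic to an algebra of all complex continuous functions on a compact space.\<close>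

definition conjugation_closed :: "('f::topological_field, 'a) module \<Rightarrow> bool" where
  "conjugation_closed A \<longleftrightarrow> (\<forall>\<phi> :: 'f \<Rightarrow> complex. complex_identification \<phi> \<longrightarrow>
     (\<forall>a\<in>carrier A. \<exists>b\<in>carrier A. \<forall>M\<in>maximal_ideals A.
        \<phi> (residue_value A M b) = cnj (\<phi> (residue_value A M a))))"

definition GA_obj :: "('f::topological_field, 'a) module \<Rightarrow> bool" where
  "GA_obj A \<longleftrightarrow> F_algebra A \<and> gelfand A \<and> semisimple A \<and>
     (\<forall>a\<in>carrier A. compact (spectrum A a)) \<and>
     (\<forall>P. primeideal P A \<longrightarrow> (\<exists>!M. M \<in> maximal_ideals A \<and> P \<subseteq> M)) \<and>
     complete_wrt (canonical_uniformity A) (carrier A) \<and>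
     conjugation_closed A"

section \<open>Algebras of continuous functions and the Stone-Weierstrass property\<close>

definition C_obj :: "'x topology \<Rightarrow> ('f::topological_field, 'x \<Rightarrow> 'f) module" where
  "C_obj S = \<lparr>
     carrier = {f \<in> extensional (topspace S). continuous_map S euclidean f},
     mult = (\<lambda>f g. \<lambda>x\<in>topspace S. f x * g x),
     one = (\<lambda>x\<in>topspace S. 1),
     zero = (\<lambda>x\<in>topspace S. 0),
     add = (\<lambda>f g. \<lambda>x\<in>topspace S. f x + g x),
     smult = (\<lambda>k f. \<lambda>x\<in>topspace S. k * f x)\<rparr>"

definition separates_points :: "'x topology \<Rightarrow> ('x \<Rightarrow> 'f) set \<Rightarrow> bool" where
  "separates_points S B \<longleftrightarrow>
     (\<forall>x\<in>topspace S. \<forall>y\<in>topspace S. x \<noteq> y \<longrightarrow> (\<exists>g\<in>B. g x \<noteq> g y))"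

definition uniformly_dense :: "'x topology \<Rightarrow> ('x \<Rightarrow> 'f::topological_field) set \<Rightarrow> bool" where
  "uniformly_dense S B \<longleftrightarrow>
     (\<forall>f\<in>carrier (C_obj S :: ('f, 'x \<Rightarrow> 'f) module). \<forall>U\<in>symmetric_nbhds_0.
        \<exists>g\<in>B. \<forall>x\<in>topspace S. g x - f x \<in> U)"

text \<open>The second type argument is the type of the points of the compact Hausdorff spaces
  considered, since a definition cannot quantify over types.  The constants belong to \<open>B\<close>
  because an \<open>F\<close>-subalgebra contains the unit.\<close>

definition stone_weierstrass ::
    "'f::topological_field itself \<Rightarrow> 'x itself \<Rightarrow> bool" where
  "stone_weierstrass _ _ \<longleftrightarrow>
     (\<forall>S :: 'x topology. compact_space S \<and> Hausdorff_space S \<longrightarrow>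
       (\<forall>B. F_subalgebra B (C_obj S :: ('f, 'x \<Rightarrow> 'f) module) \<and> separates_points S B \<and>
            (\<forall>\<phi> :: 'f \<Rightarrow> complex. complex_identification \<phi> \<longrightarrow>
               (\<forall>f\<in>B. (\<lambda>x\<in>topspace S. inv_into UNIV \<phi> (cnj (\<phi> (f x)))) \<in> B)) \<longrightarrow>
          uniformly_dense S B))"

section \<open>The two functors and the unit and counit\<close>

definition C_map :: "'x topology \<Rightarrow> 'y topology \<Rightarrow> ('x \<Rightarrow> 'y) \<Rightarrow>
    ('y \<Rightarrow> 'f::topological_field) \<Rightarrow> 'x \<Rightarrow> 'f" where
  "C_map S T f = (\<lambda>g\<in>carrier (C_obj T :: ('f, 'y \<Rightarrow> 'f) module). compose (topspace S) g f)"

text \<open>The hull-kernel (Zariski) topology, with the sets \<open>{M. a \<notin> M}\<close> as a base.\<close>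

definition Max_obj :: "('f::topological_field, 'a) module \<Rightarrow> 'a set topology" where
  "Max_obj A = topology_generated_by {{M \<in> maximal_ideals A. a \<notin> M} | a. a \<in> carrier A}"

definition Max_map :: "('f::topological_field, 'a) module \<Rightarrow> ('f, 'b) module \<Rightarrow>
    ('a \<Rightarrow> 'b) \<Rightarrow> 'b set \<Rightarrow> 'a set" where
  "Max_map A B h = (\<lambda>N\<in>maximal_ideals B. {a \<in> carrier A. h a \<in> N})"

definition point_ideal :: "'x topology \<Rightarrow> 'x \<Rightarrow> ('x \<Rightarrow> 'f::topological_field) set" where
  "point_ideal S = (\<lambda>x\<in>topspace S. {g \<in> carrier (C_obj S :: ('f, 'x \<Rightarrow> 'f) module). g x = 0})"

definition gelfand_transform :: "('f::topological_field, 'a) module \<Rightarrow> 'a \<Rightarrow> 'a set \<Rightarrow> 'f" where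
  "gelfand_transform A = (\<lambda>a\<in>carrier A. \<lambda>M\<in>maximal_ideals A. residue_value A M a)"

end

theory Submission
  imports Defs
begin

text \<open>
  The duality rests on identifying the maximal ideals of an algebra with its characters, the unital
  \<open>F\<close>-linear ring homomorphisms to \<open>F\<close>. Every character has a maximal kernel, and in a Gelfand
  algebra every maximal ideal arises in this way, from the character that reads off residues.

  From algebras to spaces (\<open>KH_obj_Max_obj\<close>): the condition on prime ideals yields, for distinct
  maximal ideals \<open>M\<close> and \<open>N\<close>, elements \<open>a \<notin> M\<close> and \<open>b \<notin> N\<close> with \<open>a b = 0\<close>, so the Zariski topology
  is Hausdorff. The characters form a closed subset of the product of all spectra, which is compact
  when the spectra are. The kernel map is a continuous surjection from this compact space onto the
  Hausdorff space \<open>Max(A)\<close>, hence closed; so \<open>Max(A)\<close> is compact and the elements of \<open>A\<close> induce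
  continuous functions on it. These functions are the ones that the \<open>F\<close>-Tychonoff property needs.

  From spaces to algebras (\<open>GA_obj_C_obj\<close>): the crucial point is that an ideal \<open>I\<close> of \<open>C(S)\<close> without
  a common zero contains a unit (\<open>nowhere_zero_in_ideal\<close>). Over the complex numbers one uses sums of
  terms \<open>f cnj f\<close>. Other fields, such as the algebraically closed field of \<open>p\<close>-adic complex numbers, may
  have no polynomial in several variables that vanishes only at the origin. If the type
  of the points is finite, indicator functions suffice; otherwise one extends the members of \<open>I\<close> by
  zero to an additional isolated point \<open>p\<close> and adds the constants. This subalgebra separates points,
  so by the Stone-Weierstrass theorem it has a member close to \<open>0\<close> at \<open>p\<close> and close to \<open>1\<close> on \<open>S\<close>,
  and then \<open>I\<close> has a member close to \<open>1\<close>. Thus the maximal ideals of \<open>C(S)\<close> are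
  the point ideals. The remaining properties of \<open>C(S)\<close> follow; that two distinct points carry
  functions with disjoint supports gives the condition on prime ideals, and completeness of the
  field gives completeness of \<open>C(S)\<close>.

  The unit \<open>S \<rightarrow> Max(C(S))\<close> is then a continuous bijection from a compact space to a Hausdorff space.
  The Gelfand transform \<open>A \<rightarrow> C(Max(A))\<close> is injective by semisimplicity. Its image is dense by the
  Stone-Weierstrass theorem, and everything in the closure is attained because \<open>A\<close> is complete
  (\<open>gelfand_transform_surj\<close>).
\<close>

section \<open>Neighbourhoods of zero and uniformities\<close>

lemma continuous_map_iff_tendsto:
  fixes f :: "'x \<Rightarrow> 'f::topological_space"
  shows "continuous_map S euclidean f \<longleftrightarrow> (\<forall>x\<in>topspace S. (f \<longlongrightarrow> f x) (atin S x))"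
  by (simp add: continuous_map_atin limitin_canonical_iff)

lemma
  fixes f g :: "'x \<Rightarrow> 'f::topological_field"
  assumes f: "continuous_map S euclidean f"
  shows continuous_map_field_add: "continuous_map S euclidean g \<Longrightarrow> continuous_map S euclidean (\<lambda>x. f x + g x)"
    and continuous_map_field_mult: "continuous_map S euclidean g \<Longrightarrow> continuous_map S euclidean (\<lambda>x. f x * g x)"
    and continuous_map_field_uminus: "continuous_map S euclidean (\<lambda>x. - f x)"
    and continuous_map_field_inverse:
      "(\<And>x. x \<in> topspace S \<Longrightarrow> f x \<noteq> 0) \<Longrightarrow> continuous_map S euclidean (\<lambda>x. inverse (f x))"
  using f unfolding continuous_map_iff_tendsto
  by (simp_all add: tendsto_add tendsto_mult tendsto_minus
      filterlim_compose[OF tendsto_inverse_nhds])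

lemma continuous_map_field_diff:
  fixes f g :: "'x \<Rightarrow> 'f::topological_field"
  assumes "continuous_map S euclidean f" "continuous_map S euclidean g"
  shows "continuous_map S euclidean (\<lambda>x. f x - g x)"
  using continuous_map_field_add[OF assms(1) continuous_map_field_uminus[OF assms(2)]] by simp

lemma symmetric_nbhds_0D:
  assumes "U \<in> symmetric_nbhds_0"
  shows "open U" "0 \<in> U" "x \<in> U \<Longrightarrow> - x \<in> U" "x - y \<in> U \<Longrightarrow> y - x \<in> U"
proof -
  show "open U" "0 \<in> U" using assms by (auto simp: symmetric_nbhds_0_def)
  have *: "- x \<in> U" if "x \<in> U" for x
    using assms that by (auto simp: symmetric_nbhds_0_def)
  show "x \<in> U \<Longrightarrow> - x \<in> U" by (rule *)
  show "x - y \<in> U \<Longrightarrow> y - x \<in> U" using *[of "x - y"] by simp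
qed

lemma UNIV_symmetric_nbhd: "UNIV \<in> symmetric_nbhds_0"
  by (simp add: symmetric_nbhds_0_def)

lemma open_uminus_image:
  fixes U :: "'f::topological_field set"
  assumes "open U" shows "open (uminus ` U)"
proof -
  have "uminus ` U = uminus -` U"
    by (auto simp: image_iff) (metis minus_minus)
  moreover have "continuous_map euclidean euclidean (uminus :: 'f \<Rightarrow> 'f)"
    using continuous_map_field_uminus[of euclidean "\<lambda>x. x"] by simp
  ultimately show ?thesis
    using assms by (auto simp: continuous_map_def vimage_def)
qed

lemma symmetric_nbhd_subset:
  fixes U :: "'f::topological_field set"
  assumes "open U" "0 \<in> U"
  obtains V where "V \<in> symmetric_nbhds_0" "V \<subseteq> U"
proof
  show "U \<inter> uminus ` U \<in> symmetric_nbhds_0"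
    using assms open_uminus_image[OF assms(1)]
    by (auto simp: symmetric_nbhds_0_def image_iff) (metis minus_minus)
qed auto

lemma symmetric_nbhds_Int:
  assumes "U \<in> symmetric_nbhds_0" "V \<in> symmetric_nbhds_0"
  shows "U \<inter> V \<in> symmetric_nbhds_0"
  using assms by (auto simp: symmetric_nbhds_0_def image_Int)

text \<open>Joint continuity of addition at \<open>(0, 0)\<close>.\<close>

lemma symmetric_nbhd_half:
  fixes U :: "'f::topological_field set"
  assumes "U \<in> symmetric_nbhds_0"
  obtains V where "V \<in> symmetric_nbhds_0" "\<And>x y. x \<in> V \<Longrightarrow> y \<in> V \<Longrightarrow> x + y \<in> U"
proof -
  have "LIM x (nhds 0 \<times>\<^sub>F nhds 0). fst x + snd x :> nhds (0 + 0 :: 'f)"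
    by (rule tendsto_add_Pair)
  then have "eventually (\<lambda>p. fst p + snd p \<in> U) (nhds (0::'f) \<times>\<^sub>F nhds 0)"
    using symmetric_nbhds_0D(1,2)[OF assms] topological_tendstoD by fastforce
  then obtain P Q where "eventually P (nhds (0::'f))" "eventually Q (nhds (0::'f))"
      and PQ: "\<And>x y. P x \<Longrightarrow> Q y \<Longrightarrow> x + y \<in> U"
    by (auto simp: eventually_prod_filter)
  then have "eventually (\<lambda>x. P x \<and> Q x) (nhds 0)"
    by (simp add: eventually_conj)
  then obtain W where "open W" "0 \<in> W" "\<forall>x\<in>W. P x \<and> Q x"
    unfolding eventually_nhds by blast
  with PQ show ?thesis
    by (metis symmetric_nbhd_subset subsetD that)
qed

text \<open>A set that is open but neither empty nor everything separates some \<open>u\<close> from some \<open>v\<close>; an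
  affine map carries the pair \<open>0, a\<close> to \<open>u, v\<close>, so the preimage of the set separates \<open>0\<close> from \<open>a\<close>.\<close>

lemma symmetric_nbhd_avoiding:
  fixes a :: "'f::topological_field"
  assumes "a \<noteq> 0"
  obtains U where "U \<in> symmetric_nbhds_0" "a \<notin> U"
proof -
  obtain W :: "'f set" and u v where W: "open W" "u \<in> W" "v \<notin> W"
    using not_indiscrete by blast
  define p where "p t = u + t * ((v - u) / a)" for t
  have "continuous_map euclidean euclidean p"
    unfolding p_def
    by (intro continuous_map_field_add continuous_map_field_mult) auto
  then have "open (p -` W)"
    using W by (auto simp: continuous_map_def vimage_def)
  moreover have "0 \<in> p -` W" "a \<notin> p -` W" using W assms by (auto simp: p_def)
  ultimately show ?thesis
    by (metis symmetric_nbhd_subset subsetD that)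
qed

lemma eq_if_difference_small:
  fixes x y :: "'f::topological_field"
  assumes "\<And>U. U \<in> symmetric_nbhds_0 \<Longrightarrow> y - x \<in> U"
  shows "x = y"
  using symmetric_nbhd_avoiding[of "y - x"] assms by force

lemma open_translation:
  fixes U :: "'f::topological_field set"
  assumes "open U" shows "open {y. y - x \<in> U}"
proof -
  have "continuous_map euclidean euclidean (\<lambda>y::'f. y - x)"
    by (intro continuous_map_field_diff) auto
  then show ?thesis using assms by (auto simp: continuous_map_def)
qed

lemma Hausdorff_topological_field: "Hausdorff_space (euclidean :: 'f::topological_field topology)"
  unfolding Hausdorff_space_def
proof (intro allI impI)
  fix x y :: 'f
  assume "x \<in> topspace euclidean \<and> y \<in> topspace euclidean \<and> x \<noteq> y"
  then obtain U where U: "U \<in> symmetric_nbhds_0" "y - x \<notin> U"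
    using symmetric_nbhd_avoiding[of "y - x"] by auto
  obtain V where V: "V \<in> symmetric_nbhds_0" "\<And>s t. s \<in> V \<Longrightarrow> t \<in> V \<Longrightarrow> s + t \<in> U"
    using symmetric_nbhd_half[OF U(1)] by blast
  have "False" if "z - x \<in> V" "z - y \<in> V" for z
    using V(2)[OF that(1) symmetric_nbhds_0D(4)[OF V(1) that(2)]] U(2) by simp
  then have "disjnt {z. z - x \<in> V} {z. z - y \<in> V}" by (auto simp: disjnt_def)
  then show "\<exists>P Q. openin euclidean P \<and> openin euclidean Q \<and> x \<in> P \<and> y \<in> Q \<and> disjnt P Q"
    using symmetric_nbhds_0D(1,2)[OF V(1)] open_translation
    by (intro exI[of _ "{z. z - x \<in> V}"] exI[of _ "{z. z - y \<in> V}"]) auto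
qed

lemma closed_singleton_field: "closed {a::'f::topological_field}"
  using closedin_Hausdorff_singleton[OF Hausdorff_topological_field, of a] by simp

lemma continuous_map_nbhd:
  fixes f :: "'x \<Rightarrow> 'f::topological_field"
  assumes "\<And>x U. x \<in> topspace S \<Longrightarrow> U \<in> symmetric_nbhds_0 \<Longrightarrow>
     \<exists>W. openin S W \<and> x \<in> W \<and> (\<forall>y\<in>W. f y - f x \<in> U)"
  shows "continuous_map S euclidean f"
  unfolding continuous_map_eq_topcontinuous_at topcontinuous_at_def
proof (intro ballI conjI allI impI)
  fix x V assume x: "x \<in> topspace S" and V: "openin euclidean V \<and> f x \<in> V"
  have "open {z. z + f x \<in> V}" using open_translation[of V "- f x"] V by simp
  then obtain U where U: "U \<in> symmetric_nbhds_0" "U \<subseteq> {z. z + f x \<in> V}"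
    using symmetric_nbhd_subset[of "{z. z + f x \<in> V}"] V by auto
  obtain W where W: "openin S W" "x \<in> W" "\<forall>y\<in>W. f y - f x \<in> U"
    using assms[OF x U(1)] by (elim exE conjE)
  have "f y \<in> V" if "f y - f x \<in> U" for y using subsetD[OF U(2) that] by simp
  with W show "\<exists>W. openin S W \<and> x \<in> W \<and> (\<forall>y\<in>W. f y \<in> V)" by blast
qed auto

lemma continuous_map_nbhdD:
  fixes f :: "'x \<Rightarrow> 'f::topological_field"
  assumes "continuous_map S euclidean f" "x \<in> topspace S" "U \<in> symmetric_nbhds_0"
  obtains W where "openin S W" "x \<in> W" "\<And>y. y \<in> W \<Longrightarrow> f y - f x \<in> U"
proof
  show "openin S {y \<in> topspace S. f y \<in> {z. z - f x \<in> U}}"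
    using assms open_translation[OF symmetric_nbhds_0D(1)[OF assms(3)]]
    by (intro openin_continuous_map_preimage[OF assms(1)]) simp
qed (use assms symmetric_nbhds_0D(2) in auto)

text \<open>The additive and the canonical uniformity, and later the filter of approximations to a
  continuous function, are all given by sets \<open>E U\<close> indexed by symmetric neighbourhoods \<open>U\<close> of zero.
  As \<open>E\<close> is monotone and these neighbourhoods are closed under intersection, the sets form a filter
  base.\<close>

lemma eventually_INF_symmetric_nbhds:
  assumes "\<And>U V. U \<subseteq> V \<Longrightarrow> E U \<subseteq> E V"
  shows "eventually P (INF U\<in>symmetric_nbhds_0. principal (E (U :: 'f::topological_field set)))
     \<longleftrightarrow> (\<exists>U\<in>symmetric_nbhds_0. \<forall>p\<in>E U. P p)"
proof (subst eventually_INF_base)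
  show "symmetric_nbhds_0 \<noteq> ({} :: 'f set set)" using UNIV_symmetric_nbhd by blast
  show "\<exists>W\<in>symmetric_nbhds_0. principal (E W) \<le> inf (principal (E U)) (principal (E V))"
    if "U \<in> symmetric_nbhds_0" "V \<in> symmetric_nbhds_0" for U V
    using symmetric_nbhds_Int[OF that] assms by (intro bexI[of _ "U \<inter> V"]) auto
qed (simp add: eventually_principal)

lemma eventually_additive_uniformity:
  "eventually P (additive_uniformity :: ('f::topological_field \<times> 'f) filter) \<longleftrightarrow>
     (\<exists>U\<in>symmetric_nbhds_0. \<forall>x y. y - x \<in> U \<longrightarrow> P (x, y))"
  unfolding additive_uniformity_def
  by (subst eventually_INF_symmetric_nbhds) auto

lemma eventually_canonical_uniformity:
  fixes A :: "('f::topological_field, 'a) module"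
  shows "eventually P (canonical_uniformity A) \<longleftrightarrow>
     (\<exists>U\<in>symmetric_nbhds_0. \<forall>a\<in>carrier A. \<forall>b\<in>carrier A.
        (\<forall>M\<in>maximal_ideals A. residue_value A M (b \<ominus>\<^bsub>A\<^esub> a) \<in> U) \<longrightarrow> P (a, b))"
  unfolding canonical_uniformity_def
  by (subst eventually_INF_symmetric_nbhds) auto

section \<open>Characters and maximal ideals\<close>

lemma scalars_simps [simp]:
  "carrier (scalars :: 'f::topological_field ring) = UNIV"
  "x \<otimes>\<^bsub>(scalars :: 'f ring)\<^esub> y = x * y"
  "x \<oplus>\<^bsub>(scalars :: 'f ring)\<^esub> y = x + y"
  "\<one>\<^bsub>(scalars :: 'f ring)\<^esub> = 1"
  "\<zero>\<^bsub>(scalars :: 'f ring)\<^esub> = 0"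
  by (simp_all add: ring_of_type_algebra_def)

lemma cring_scalars: "cring (scalars :: 'f::topological_field ring)"
  by (rule cring_from_type_algebra)

definition character :: "('f::topological_field, 'a) module \<Rightarrow> ('a \<Rightarrow> 'f) \<Rightarrow> bool" where
  "character A \<psi> \<longleftrightarrow> \<psi> \<one>\<^bsub>A\<^esub> = 1 \<and>
     (\<forall>a\<in>carrier A. \<forall>b\<in>carrier A. \<psi> (a \<oplus>\<^bsub>A\<^esub> b) = \<psi> a + \<psi> b \<and> \<psi> (a \<otimes>\<^bsub>A\<^esub> b) = \<psi> a * \<psi> b) \<and>
     (\<forall>k. \<forall>a\<in>carrier A. \<psi> (k \<odot>\<^bsub>A\<^esub> a) = k * \<psi> a)"

definition char_kernel :: "('f::topological_field, 'a) module \<Rightarrow> ('a \<Rightarrow> 'f) \<Rightarrow> 'a set" where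
  "char_kernel A \<psi> = {a \<in> carrier A. \<psi> a = 0}"

locale F_alg =
  fixes A :: "('f::topological_field, 'a) module" (structure)
  assumes F_algebra: "F_algebra A"
begin

sublocale Module.algebra scalars A
  using F_algebra by (simp add: F_algebra_def)

lemma scalar_closed [simp]: "scalar A k \<in> carrier A"
  by (simp add: scalar_def)

lemma smult_eq_scalar_mult: "a \<in> carrier A \<Longrightarrow> k \<odot>\<^bsub>A\<^esub> a = scalar A k \<otimes> a"
  using smult_assoc2[of k \<one> a] by (simp add: scalar_def)

lemma scalar_add: "scalar A (k + l) = scalar A k \<oplus> scalar A l"
  using smult_l_distr[of k l \<one>] by (simp add: scalar_def)

lemma scalar_one: "scalar A 1 = \<one>"
  using smult_one[of \<one>] by (simp add: scalar_def)

lemma scalar_mult: "scalar A (k * l) = scalar A k \<otimes> scalar A l"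
  using smult_assoc1[of k l \<one>] smult_eq_scalar_mult[of "scalar A l" k]
  by (simp add: scalar_def)

context
  fixes \<psi> assumes \<psi>: "character A \<psi>"
begin

lemma character_one: "\<psi> \<one> = 1"
  and character_add: "a \<in> carrier A \<Longrightarrow> b \<in> carrier A \<Longrightarrow> \<psi> (a \<oplus> b) = \<psi> a + \<psi> b"
  and character_mult: "a \<in> carrier A \<Longrightarrow> b \<in> carrier A \<Longrightarrow> \<psi> (a \<otimes> b) = \<psi> a * \<psi> b"
  and character_smult: "a \<in> carrier A \<Longrightarrow> \<psi> (k \<odot>\<^bsub>A\<^esub> a) = k * \<psi> a"
  using \<psi> by (simp_all add: character_def)

lemma character_zero: "\<psi> \<zero> = 0"
proof -
  have "\<psi> \<zero> + \<psi> \<zero> = \<psi> \<zero> + 0"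
    using character_add[of \<zero> \<zero>] by simp
  then show ?thesis by (simp only: add_left_cancel)
qed

lemma character_minus: "a \<in> carrier A \<Longrightarrow> \<psi> (\<ominus> a) = - \<psi> a"
  using character_add[of a "\<ominus> a"] by (simp add: M.r_neg character_zero eq_neg_iff_add_eq_0 add.commute)

lemma character_diff: "a \<in> carrier A \<Longrightarrow> b \<in> carrier A \<Longrightarrow> \<psi> (a \<ominus> b) = \<psi> a - \<psi> b"
  by (simp add: a_minus_def character_add character_minus)

lemma character_scalar: "\<psi> (scalar A k) = k"
  by (simp add: scalar_def character_smult character_one)

lemma ideal_char_kernel: "ideal (char_kernel A \<psi>) A"
proof (rule idealI)
  show "ring A" by (rule cring.axioms(1)[OF M_cring])
  show "subgroup (char_kernel A \<psi>) (add_monoid A)"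
    by (rule M.add.subgroupI)
      (auto simp: char_kernel_def character_add character_zero character_minus a_inv_def[symmetric]
        intro!: exI[of _ \<zero>])
qed (auto simp: char_kernel_def character_mult)

text \<open>The kernel has codimension one: modulo it every \<open>j\<close> is the scalar \<open>\<psi> j\<close>, so that an ideal
  which contains the kernel and one more element contains a nonzero scalar.\<close>

lemma maximalideal_char_kernel: "maximalideal (char_kernel A \<psi>) A"
proof (rule maximalidealI)
  show "ideal (char_kernel A \<psi>) A" by (rule ideal_char_kernel)
  show "carrier A \<noteq> char_kernel A \<psi>"
  proof
    assume "carrier A = char_kernel A \<psi>"
    then have "\<one> \<in> char_kernel A \<psi>" using scalar_closed[of 1] by (simp add: scalar_one)
    then show False by (simp add: char_kernel_def character_one)
  qed
  fix J assume J: "ideal J A" "char_kernel A \<psi> \<subseteq> J" "J \<subseteq> carrier A"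
  interpret J: ideal J A by fact
  show "J = char_kernel A \<psi> \<or> J = carrier A"
  proof (cases "J \<subseteq> char_kernel A \<psi>")
    case False
    then obtain j where j: "j \<in> J" "j \<in> carrier A" "\<psi> j \<noteq> 0"
      using J by (auto simp: char_kernel_def)
    define u where "u = scalar A (inverse (\<psi> j)) \<otimes> j"
    have u: "u \<in> J" "u \<in> carrier A" "\<psi> u = 1"
      using j J.I_l_closed by (auto simp: u_def character_mult character_scalar)
    have "\<one> \<ominus> u \<in> J"
      using J(2) u by (auto simp: char_kernel_def character_diff character_one)
    then have "(\<one> \<ominus> u) \<oplus> u \<in> J" using u J.a_closed by blast
    moreover have "(\<one> \<ominus> u) \<oplus> u = \<one>"
      using u by (simp add: a_minus_def M.a_assoc M.l_neg)
    ultimately show ?thesis using J.one_imp_carrier by simp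
  qed (use J in auto)
qed

lemma char_kernel_maximal: "char_kernel A \<psi> \<in> maximal_ideals A"
  using maximalideal_char_kernel by (simp add: maximal_ideals_def)

lemma coset_char_kernel_eq_iff:
  assumes "a \<in> carrier A" "b \<in> carrier A"
  shows "char_kernel A \<psi> +> a = char_kernel A \<psi> +> b \<longleftrightarrow> \<psi> a = \<psi> b"
  using quotient_eq_iff_same_a_r_cos[OF ideal_char_kernel assms] assms
  by (simp add: char_kernel_def character_diff)

text \<open>Cosets of the kernel of \<open>\<psi>\<close> correspond to values of \<open>\<psi>\<close>. An algebra is therefore Gelfand as
  soon as all its maximal ideals are kernels of characters, and the residue of \<open>a\<close> modulo such a
  kernel is \<open>\<psi> a\<close>.\<close>

lemma canonical_map_char_kernel: "canonical_map A (char_kernel A \<psi>) \<in> ring_iso scalars (A Quot char_kernel A \<psi>)"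
proof (rule ring_iso_memI)
  interpret I: ideal "char_kernel A \<psi>" A by (rule ideal_char_kernel)
  note hom = I.rcos_ring_hom
  show "canonical_map A (char_kernel A \<psi>) x \<in> carrier (A Quot char_kernel A \<psi>)" for x
    using ring_hom_memE(1)[OF hom] by (simp add: canonical_map_def)
  show "canonical_map A (char_kernel A \<psi>) (x \<otimes>\<^bsub>scalars\<^esub> y) =
      canonical_map A (char_kernel A \<psi>) x \<otimes>\<^bsub>A Quot char_kernel A \<psi>\<^esub> canonical_map A (char_kernel A \<psi>) y" for x y
    using ring_hom_memE(2)[OF hom] by (simp add: canonical_map_def scalar_mult)
  show "canonical_map A (char_kernel A \<psi>) (x \<oplus>\<^bsub>scalars\<^esub> y) =
      canonical_map A (char_kernel A \<psi>) x \<oplus>\<^bsub>A Quot char_kernel A \<psi>\<^esub> canonical_map A (char_kernel A \<psi>) y" for x y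
    using ring_hom_memE(3)[OF hom] by (simp add: canonical_map_def scalar_add)
  show "canonical_map A (char_kernel A \<psi>) \<one>\<^bsub>scalars\<^esub> = \<one>\<^bsub>A Quot char_kernel A \<psi>\<^esub>"
    using ring_hom_memE(4)[OF hom] by (simp add: canonical_map_def scalar_one)
  have "carrier (A Quot char_kernel A \<psi>) = (\<lambda>a. char_kernel A \<psi> +> a) ` carrier A"
    by (auto simp: FactRing_simps)
  also have "\<dots> = range (canonical_map A (char_kernel A \<psi>))"
  proof -
    have *: "char_kernel A \<psi> +> a = canonical_map A (char_kernel A \<psi>) (\<psi> a)" if "a \<in> carrier A" for a
      using that by (simp add: canonical_map_def coset_char_kernel_eq_iff character_scalar)
    show ?thesis
    proof (intro subset_antisym image_subsetI)
      show "char_kernel A \<psi> +> a \<in> range (canonical_map A (char_kernel A \<psi>))" if "a \<in> carrier A" for a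
        using *[OF that] by (rule range_eqI)
      show "canonical_map A (char_kernel A \<psi>) k \<in> (\<lambda>a. char_kernel A \<psi> +> a) ` carrier A" for k
        unfolding canonical_map_def by (rule imageI) simp
    qed
  qed
  finally show "bij_betw (canonical_map A (char_kernel A \<psi>)) (carrier scalars) (carrier (A Quot char_kernel A \<psi>))"
    by (simp add: bij_betw_def inj_on_def canonical_map_def coset_char_kernel_eq_iff character_scalar)
qed

lemma residue_value_char_kernel:
  assumes "a \<in> carrier A"
  shows "residue_value A (char_kernel A \<psi>) a = \<psi> a"
  unfolding residue_value_def
proof (rule the_inv_into_f_eq)
  show "inj (canonical_map A (char_kernel A \<psi>))"
    by (simp add: inj_on_def canonical_map_def coset_char_kernel_eq_iff character_scalar)
  show "canonical_map A (char_kernel A \<psi>) (\<psi> a) = char_kernel A \<psi> +> a"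
    using assms by (simp add: canonical_map_def coset_char_kernel_eq_iff character_scalar)
qed simp

lemma character_in_spectrum:
  assumes "a \<in> carrier A"
  shows "\<psi> a \<in> spectrum A a"
proof -
  have "a \<ominus> scalar A (\<psi> a) \<notin> Units A"
  proof
    assume u: "a \<ominus> scalar A (\<psi> a) \<in> Units A"
    have "\<psi> ((a \<ominus> scalar A (\<psi> a)) \<otimes> inv (a \<ominus> scalar A (\<psi> a))) = 0"
      by (subst character_mult) (use u assms in \<open>auto simp: character_diff character_scalar\<close>)
    moreover have "(a \<ominus> scalar A (\<psi> a)) \<otimes> inv (a \<ominus> scalar A (\<psi> a)) = \<one>"
      using u by (rule Units_r_inv)
    ultimately show False by (simp add: character_one)
  qed
  then show ?thesis by (simp add: spectrum_def)
qed

end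

text \<open>In a Gelfand algebra every maximal ideal is the kernel of the character that reads off
  residues modulo it.\<close>

lemma
  assumes "gelfand A" and M: "M \<in> maximal_ideals A"
  shows character_residue_value: "character A (residue_value A M)"
    and char_kernel_residue_value: "char_kernel A (residue_value A M) = M"
proof -
  have iso: "canonical_map A M \<in> ring_iso scalars (A Quot M)"
    using assms by (simp add: gelfand_def)
  interpret maximalideal M A using M by (simp add: maximal_ideals_def)
  have M_ideal: "ideal M A" by (rule ideal_axioms)
  have bij: "bij_betw (canonical_map A M) UNIV (carrier (A Quot M))"
    using ring_iso_memE(5)[OF iso] by simp
  \<comment> \<open>The residue of \<open>a\<close> is characterized by an equation between cosets, so each law for residues
    follows from the same law for the quotient ring.\<close>
  have *: "M +> a = canonical_map A M k \<longleftrightarrow> residue_value A M a = k" if a: "a \<in> carrier A" for a k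
  proof -
    have "M +> a \<in> range (canonical_map A M)"
      using bij_betw_imp_surj_on[OF bij] ring_hom_memE(1)[OF rcos_ring_hom a] by simp
    then have "canonical_map A M (residue_value A M a) = M +> a"
      unfolding residue_value_def using bij_betw_imp_inj_on[OF bij]
      by (intro f_the_inv_into_f)
    then show ?thesis
      using bij_betw_imp_inj_on[OF bij] by (metis injD)
  qed
  have hom: "canonical_map A M \<in> ring_hom scalars (A Quot M)"
    using iso by (simp add: ring_iso_def)
  have eq: "M +> a = canonical_map A M (residue_value A M a)" if "a \<in> carrier A" for a
    using *[OF that] by blast
  have 1: "residue_value A M \<one> = 1"
    using *[of \<one> 1] ring_hom_memE(4)[OF hom] ring_hom_memE(4)[OF rcos_ring_hom] by simp
  have 2: "residue_value A M (a \<oplus> b) = residue_value A M a + residue_value A M b"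
    if "a \<in> carrier A" "b \<in> carrier A" for a b
    using that eq ring_hom_memE(3)[OF hom, of "residue_value A M a" "residue_value A M b"]
      ring_hom_memE(3)[OF rcos_ring_hom, of a b]
    by (subst *[symmetric]) simp_all
  have 3: "residue_value A M (a \<otimes> b) = residue_value A M a * residue_value A M b"
    if "a \<in> carrier A" "b \<in> carrier A" for a b
    using that eq ring_hom_memE(2)[OF hom, of "residue_value A M a" "residue_value A M b"]
      ring_hom_memE(2)[OF rcos_ring_hom, of a b]
    by (subst *[symmetric]) simp_all
  have 4: "residue_value A M (scalar A k) = k" for k
    using *[of "scalar A k" k] by (simp add: canonical_map_def)
  show \<psi>: "character A (residue_value A M)"
    unfolding character_def using 1 2 3 4 by (simp add: smult_eq_scalar_mult)
  have "residue_value A M a = 0 \<longleftrightarrow> a \<in> M" if a: "a \<in> carrier A" for a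
  proof -
    have "scalar A 0 = \<zero>"
      using smult_l_null[of \<one>] by (simp add: scalar_def)
    then have "residue_value A M a = 0 \<longleftrightarrow> M +> a = M +> \<zero>"
      using *[OF a, of 0] by (simp add: canonical_map_def)
    also have "\<dots> \<longleftrightarrow> a \<in> M"
      using quotient_eq_iff_same_a_r_cos[OF M_ideal a, of \<zero>] a by (simp add: a_minus_def)
    finally show ?thesis .
  qed
  then show "char_kernel A (residue_value A M) = M"
    using Icarr by (auto simp: char_kernel_def)
qed

end

section \<open>The maximal ideal space\<close>

text \<open>Krull's separation lemma: an ideal that is maximal among those disjoint from a
  multiplicatively closed set is prime.\<close>

lemma (in cring) exists_primeideal_disjoint:
  assumes S: "S \<subseteq> carrier R" "\<one> \<in> S" "\<zero> \<notin> S"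
    and mult: "\<And>s t. s \<in> S \<Longrightarrow> t \<in> S \<Longrightarrow> s \<otimes> t \<in> S"
  obtains P where "primeideal P R" "P \<inter> S = {}"
proof -
  define \<A> where "\<A> = {I. ideal I R \<and> I \<inter> S = {}}"
  have "\<exists>P\<in>\<A>. \<forall>I\<in>\<A>. P \<subseteq> I \<longrightarrow> I = P"
  proof (rule subset_Zorn_nonempty)
    have "{\<zero>} \<in> \<A>" using zeroideal S(3) by (simp add: \<A>_def)
    then show "\<A> \<noteq> {}" by blast
    fix C assume C: "C \<noteq> {}" "subset.chain \<A> C"
    then have "subset.chain {I. ideal I R} C"
      by (auto simp: pred_on.chain_def \<A>_def)
    then have "ideal (\<Union>C) R" using chain_Union_is_ideal[of C] C(1) by simp
    moreover have "\<Union>C \<inter> S = {}"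
      using C(2) by (auto simp: pred_on.chain_def \<A>_def)
    ultimately show "\<Union>C \<in> \<A>" by (simp add: \<A>_def)
  qed
  then obtain P where P: "ideal P R" "P \<inter> S = {}"
    and max: "\<And>I. ideal I R \<Longrightarrow> I \<inter> S = {} \<Longrightarrow> P \<subseteq> I \<Longrightarrow> I = P"
    by (auto simp: \<A>_def)
  interpret P: ideal P R by fact
  \<comment> \<open>The ideal generated by \<open>P\<close> and \<open>a\<close> is strictly larger than \<open>P\<close>, so by maximality it meets \<open>S\<close>.\<close>
  have meets: "\<exists>p\<in>P. \<exists>r\<in>carrier R. p \<oplus> r \<otimes> a \<in> S" if a: "a \<in> carrier R" "a \<notin> P" for a
  proof (rule ccontr)
    assume no: "\<not> ?thesis"
    define I where "I = P <+>\<^bsub>R\<^esub> PIdl a"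
    have I: "ideal I R"
      unfolding I_def by (intro add_ideals P cgenideal_ideal a)
    have I_eq: "I = {p \<oplus> r \<otimes> a | p r. p \<in> P \<and> r \<in> carrier R}"
      unfolding I_def set_add_def' cgenideal_def by blast
    have "I \<inter> S = {}" unfolding I_eq using no by blast
    moreover have "p \<in> I" if "p \<in> P" for p
      unfolding I_eq using that a(1) P.Icarr
      by (intro CollectI exI[of _ p] exI[of _ \<zero>]) simp
    ultimately have "I = P" using max I by blast
    moreover have "a \<in> I"
      unfolding I_eq using a(1) P.zero_closed
      by (intro CollectI exI[of _ \<zero>] exI[of _ \<one>]) simp
    ultimately show False using a(2) by simp
  qed
  have "primeideal P R"
  proof (rule primeidealI[OF P(1) is_cring])
    show "carrier R \<noteq> P" using P(2) S by blast
    fix a b assume ab: "a \<in> carrier R" "b \<in> carrier R" "a \<otimes> b \<in> P"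
    show "a \<in> P \<or> b \<in> P"
    proof (rule ccontr)
      assume "\<not> (a \<in> P \<or> b \<in> P)"
      then obtain p r q t where pr: "p \<in> P" "r \<in> carrier R" "p \<oplus> r \<otimes> a \<in> S"
        and qt: "q \<in> P" "t \<in> carrier R" "q \<oplus> t \<otimes> b \<in> S"
        using meets[of a] meets[of b] ab by auto
      have pq: "p \<in> carrier R" "q \<in> carrier R" using pr(1) qt(1) P.Icarr by auto
      have "(p \<oplus> r \<otimes> a) \<otimes> (q \<oplus> t \<otimes> b) = p \<otimes> (q \<oplus> t \<otimes> b) \<oplus> ((r \<otimes> a) \<otimes> q \<oplus> (r \<otimes> t) \<otimes> (a \<otimes> b))"
        using ab pr qt pq by algebra
      moreover have "p \<otimes> (q \<oplus> t \<otimes> b) \<in> P" "(r \<otimes> a) \<otimes> q \<in> P" "(r \<otimes> t) \<otimes> (a \<otimes> b) \<in> P"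
        using ab pr qt pq P.I_r_closed P.I_l_closed by auto
      ultimately have "(p \<oplus> r \<otimes> a) \<otimes> (q \<oplus> t \<otimes> b) \<in> P"
        using P.a_closed by simp
      then show False using mult[OF pr(3) qt(3)] P(2) by blast
    qed
  qed
  with P(2) show ?thesis using that by blast
qed

context F_alg
begin

lemma maximal_ideal_prime:
  "M \<in> maximal_ideals A \<Longrightarrow> a \<in> carrier A \<Longrightarrow> b \<in> carrier A \<Longrightarrow> a \<otimes> b \<in> M \<Longrightarrow> a \<in> M \<or> b \<in> M"
  using maximalideal_prime[of M] primeideal.I_prime[of M A] by (simp add: maximal_ideals_def)

lemma maximal_ideal_ideal: "M \<in> maximal_ideals A \<Longrightarrow> ideal M A"
  by (simp add: maximal_ideals_def maximalideal_def)

lemma maximal_ideal_zero: "M \<in> maximal_ideals A \<Longrightarrow> \<zero> \<in> M"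
  using maximal_ideal_ideal additive_subgroup.zero_closed ideal.axioms(1) by blast

lemma maximal_ideal_one: 
  assumes "M \<in> maximal_ideals A" shows "\<one> \<notin> M"
  using maximalideal.I_notcarr[of M A] ideal.one_imp_carrier[OF maximal_ideal_ideal[OF assms]] assms
  by (auto simp: maximal_ideals_def)

lemma topspace_Max_obj: "topspace (Max_obj A) = maximal_ideals A"
proof -
  have "\<one> \<in> carrier A" by simp
  then show ?thesis
    unfolding Max_obj_def topology_generated_by_topspace using maximal_ideal_one by blast
qed

lemma openin_Max_obj_basic:
  "a \<in> carrier A \<Longrightarrow> openin (Max_obj A) {M \<in> maximal_ideals A. a \<notin> M}"
  unfolding Max_obj_def by (rule topology_generated_by_Basis) blast

text \<open>The sets \<open>{M. a \<notin> M}\<close>, which generate the topology, are already a base: as maximal ideals are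
  prime, the intersection of the sets for \<open>a\<close> and \<open>b\<close> is the set for \<open>a b\<close>.\<close>

lemma openin_Max_obj_basicD:
  assumes "openin (Max_obj A) U" "M \<in> U"
  obtains a where "a \<in> carrier A" "a \<notin> M" "\<And>N. N \<in> maximal_ideals A \<Longrightarrow> a \<notin> N \<Longrightarrow> N \<in> U"
proof -
  define good where "good V M \<longleftrightarrow> M \<in> maximal_ideals A \<and>
      (\<exists>a\<in>carrier A. a \<notin> M \<and> {N \<in> maximal_ideals A. a \<notin> N} \<subseteq> V)" for V M
  have "generate_topology_on {{M \<in> maximal_ideals A. a \<notin> M} | a. a \<in> carrier A} U"
    using assms(1) unfolding Max_obj_def by (rule openin_topology_generated_by)
  then have "\<forall>M\<in>U. good U M"
  proof (induction rule: generate_topology_on.induct)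
    case (Int U V)
    show ?case
    proof
      fix M assume M: "M \<in> U \<inter> V"
      then have "good U M" "good V M" using Int.IH by auto
      then obtain a b where a: "a \<in> carrier A" "a \<notin> M" "{N \<in> maximal_ideals A. a \<notin> N} \<subseteq> U"
        and b: "b \<in> carrier A" "b \<notin> M" "{N \<in> maximal_ideals A. b \<notin> N} \<subseteq> V"
        and M': "M \<in> maximal_ideals A"
        unfolding good_def by (elim conjE bexE)
      have "a \<otimes> b \<notin> M" using maximal_ideal_prime[OF M' a(1) b(1)] a(2) b(2) by blast
      moreover have "N \<in> U \<inter> V" if N: "N \<in> maximal_ideals A" "a \<otimes> b \<notin> N" for N
      proof -
        have "a \<notin> N" "b \<notin> N"
          using N maximal_ideal_ideal[OF N(1)] ideal.I_r_closed[of N A a b] ideal.I_l_closed[of N A b a] a(1) b(1)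
          by auto
        then show ?thesis using a(3) b(3) N(1) by blast
      qed
      moreover have "a \<otimes> b \<in> carrier A" using a(1) b(1) by simp
      ultimately show "good (U \<inter> V) M"
        unfolding good_def using M' by (intro conjI bexI[of _ "a \<otimes> b"]) auto
    qed
  next
    case (UN K)
    show ?case
    proof
      fix M assume "M \<in> \<Union>K"
      then obtain V where "V \<in> K" "M \<in> V" by blast
      then show "good (\<Union>K) M" using UN.IH[of V] unfolding good_def by (meson Union_upper order_trans)
    qed
  qed (auto simp: good_def)
  then have "good U M" using assms(2) by blast
  then show ?thesis using that unfolding good_def by (elim conjE bexE) blast
qed

text \<open>If no product \<open>a \<otimes> b\<close> with \<open>a \<notin> M\<close> and \<open>b \<notin> N\<close> vanished, these products would form a
  multiplicatively closed set without zero, and a prime ideal avoiding it would lie in both \<open>M\<close>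
  and \<open>N\<close>.\<close>

lemma maximal_ideals_annihilating_elements:
  assumes pm: "\<And>P. primeideal P A \<Longrightarrow> \<exists>!M. M \<in> maximal_ideals A \<and> P \<subseteq> M"
    and M: "M \<in> maximal_ideals A" and N: "N \<in> maximal_ideals A" and "M \<noteq> N"
  obtains a b where "a \<in> carrier A" "b \<in> carrier A" "a \<notin> M" "b \<notin> N" "a \<otimes> b = \<zero>"
proof (rule ccontr)
  assume "\<not> thesis"
  with that have nz: "a \<otimes> b \<noteq> \<zero>"
    if "a \<in> carrier A" "b \<in> carrier A" "a \<notin> M" "b \<notin> N" for a b using that by blast
  define S where "S = {a \<otimes> b | a b. a \<in> carrier A \<and> b \<in> carrier A \<and> a \<notin> M \<and> b \<notin> N}"
  have S_I: "a \<otimes> b \<in> S" if "a \<in> carrier A" "b \<in> carrier A" "a \<notin> M" "b \<notin> N" for a b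
    using that unfolding S_def by blast
  note one = maximal_ideal_one[OF M] maximal_ideal_one[OF N]
  have in_S: "a \<in> S" if "a \<in> carrier A" "a \<notin> M \<or> a \<notin> N" for a
    using that S_I[of a \<one>] S_I[of \<one> a] one by auto
  obtain P where P: "primeideal P A" "P \<inter> S = {}"
  proof (rule cring.exists_primeideal_disjoint[OF M_cring, of S])
    show "S \<subseteq> carrier A" unfolding S_def by blast
    show "\<one> \<in> S" using in_S one by simp
    show "\<zero> \<notin> S" unfolding S_def using nz by fastforce
    fix s t assume "s \<in> S" "t \<in> S"
    then obtain a b c d where s: "s = a \<otimes> b" "a \<in> carrier A" "b \<in> carrier A" "a \<notin> M" "b \<notin> N"
      and t: "t = c \<otimes> d" "c \<in> carrier A" "d \<in> carrier A" "c \<notin> M" "d \<notin> N"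
      unfolding S_def by blast
    have "(a \<otimes> c) \<otimes> (b \<otimes> d) \<in> S"
      using s t maximal_ideal_prime[OF M] maximal_ideal_prime[OF N] by (intro S_I) blast+
    moreover have "s \<otimes> t = (a \<otimes> c) \<otimes> (b \<otimes> d)"
      using s t by (simp add: m_ac)
    ultimately show "s \<otimes> t \<in> S" by simp
  qed blast
  have "P \<subseteq> carrier A" using P(1) by (simp add: additive_subgroup.a_subset ideal.axioms(1) primeideal.axioms(1))
  then have "P \<subseteq> M" "P \<subseteq> N" using P(2) in_S by blast+
  then show False using pm[OF P(1)] M N \<open>M \<noteq> N\<close> by blast
qed

lemma Hausdorff_space_Max_obj:
  assumes "\<And>P. primeideal P A \<Longrightarrow> \<exists>!M. M \<in> maximal_ideals A \<and> P \<subseteq> M"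
  shows "Hausdorff_space (Max_obj A)"
  unfolding Hausdorff_space_def topspace_Max_obj
proof (intro allI impI)
  fix M N assume MN: "M \<in> maximal_ideals A \<and> N \<in> maximal_ideals A \<and> M \<noteq> N"
  then obtain a b where ab: "a \<in> carrier A" "b \<in> carrier A" "a \<notin> M" "b \<notin> N" "a \<otimes> b = \<zero>"
    using maximal_ideals_annihilating_elements[OF assms] by metis
  have "a \<in> L \<or> b \<in> L" if "L \<in> maximal_ideals A" for L
    using maximal_ideal_prime[OF that ab(1,2)] ab(5) maximal_ideal_zero[OF that] by simp
  then have "disjnt {L \<in> maximal_ideals A. a \<notin> L} {L \<in> maximal_ideals A. b \<notin> L}"
    by (auto simp: disjnt_def)
  then show "\<exists>U V. openin (Max_obj A) U \<and> openin (Max_obj A) V \<and> M \<in> U \<and> N \<in> V \<and> disjnt U V"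
    using MN ab openin_Max_obj_basic[OF ab(1)] openin_Max_obj_basic[OF ab(2)]
    by (intro exI[of _ "{L \<in> maximal_ideals A. a \<notin> L}"] exI[of _ "{L \<in> maximal_ideals A. b \<notin> L}"]) simp
qed

lemma character_restrict: "character A (restrict \<psi> (carrier A)) \<longleftrightarrow> character A \<psi>"
  by (simp add: character_def)

lemma char_kernel_restrict: "char_kernel A (restrict \<psi> (carrier A)) = char_kernel A \<psi>"
  by (auto simp: char_kernel_def)

text \<open>Restricting the coordinate at \<open>a\<close> to the spectrum of \<open>a\<close> loses no character, and the
  product of the spectra is compact when all spectra are.\<close>

definition char_space :: "('a \<Rightarrow> 'f) topology" where
  "char_space = subtopology (product_topology (\<lambda>a. subtopology euclidean (spectrum A a)) (carrier A))
     (Collect (character A))"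

lemma topspace_char_space: "topspace char_space = {\<psi> \<in> extensional (carrier A). character A \<psi>}"
  using character_in_spectrum by (auto simp: char_space_def PiE_def)

lemma continuous_map_char_space_eval:
  assumes "a \<in> carrier A"
  shows "continuous_map char_space euclidean (\<lambda>\<psi>. \<psi> a)"
  using continuous_map_product_projection[OF assms, of "\<lambda>a. subtopology euclidean (spectrum A a)"]
  unfolding char_space_def by (simp add: continuous_map_from_subtopology continuous_map_in_subtopology)

text \<open>The equations that define a character are closed conditions on points of the product of all
  spectra, which is compact by Tychonoff's theorem.\<close>

lemma compact_space_char_space:
  assumes "\<And>a. a \<in> carrier A \<Longrightarrow> compact (spectrum A a)"
  shows "compact_space char_space"
proof -
  define P where "P = product_topology (\<lambda>a. subtopology euclidean (spectrum A a)) (carrier A)"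
  have P: "compact_space P"
    using assms unfolding P_def compact_space_product_topology
    by (simp add: compact_space_subtopology)
  have ev: "continuous_map P euclidean (\<lambda>\<psi>. \<psi> a)" if "a \<in> carrier A" for a
    using continuous_map_product_projection[OF that, of "\<lambda>a. subtopology euclidean (spectrum A a)"]
    unfolding P_def by (simp add: continuous_map_in_subtopology)
  note eq = closedin_continuous_maps_eq[OF Hausdorff_topological_field]
  define \<E> where "\<E> =
     {{\<psi> \<in> topspace P. \<psi> \<one> = 1}} \<union>
     {{\<psi> \<in> topspace P. \<psi> (a \<oplus> b) = \<psi> a + \<psi> b} | a b. a \<in> carrier A \<and> b \<in> carrier A} \<union>
     {{\<psi> \<in> topspace P. \<psi> (a \<otimes> b) = \<psi> a * \<psi> b} | a b. a \<in> carrier A \<and> b \<in> carrier A} \<union>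
     {{\<psi> \<in> topspace P. \<psi> (k \<odot>\<^bsub>A\<^esub> a) = k * \<psi> a} | k a. a \<in> carrier A}"
  have "closedin P E" if "E \<in> \<E>" for E
    using that unfolding \<E>_def
    by (elim UnE CollectE exE conjE singletonE; hypsubst)
      (intro eq ev continuous_map_field_add continuous_map_field_mult; simp)+
  then have "closedin P (\<Inter>\<E>)" by (intro closedin_Inter) (auto simp: \<E>_def)
  moreover have "\<Inter>\<E> = topspace P \<inter> Collect (character A)"
  proof (intro subset_antisym subsetI)
    fix \<psi> assume "\<psi> \<in> \<Inter>\<E>"
    then have *: "\<psi> \<in> E" if "E \<in> \<E>" for E using that by (rule InterD)
    have "\<psi> \<in> {\<psi> \<in> topspace P. \<psi> \<one> = 1}"
      by (rule *) (simp add: \<E>_def)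
    moreover have "\<psi> \<in> {\<psi> \<in> topspace P. \<psi> (a \<oplus> b) = \<psi> a + \<psi> b}"
      if "a \<in> carrier A" "b \<in> carrier A" for a b
      using that by (intro *) (unfold \<E>_def, blast)
    moreover have "\<psi> \<in> {\<psi> \<in> topspace P. \<psi> (a \<otimes> b) = \<psi> a * \<psi> b}"
      if "a \<in> carrier A" "b \<in> carrier A" for a b
      using that by (intro *) (unfold \<E>_def, blast)
    moreover have "\<psi> \<in> {\<psi> \<in> topspace P. \<psi> (k \<odot>\<^bsub>A\<^esub> a) = k * \<psi> a}" if "a \<in> carrier A" for k a
      using that by (intro *) (unfold \<E>_def, blast)
    ultimately show "\<psi> \<in> topspace P \<inter> Collect (character A)"
      by (simp add: character_def)
  next
    fix \<psi> assume "\<psi> \<in> topspace P \<inter> Collect (character A)"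
    then show "\<psi> \<in> \<Inter>\<E>" unfolding \<E>_def by (auto simp: character_def)
  qed
  ultimately have "compactin P (topspace P \<inter> Collect (character A))"
    using closedin_compact_space[OF P] by simp
  then show ?thesis
    unfolding char_space_def P_def[symmetric]
    by (metis compactin_subspace subtopology_restrict)
qed

lemma continuous_map_char_kernel: "continuous_map char_space (Max_obj A) (char_kernel A)"
  unfolding Max_obj_def
proof (rule continuous_on_generated_topo)
  show "char_kernel A ` topspace char_space \<subseteq> \<Union>{{M \<in> maximal_ideals A. a \<notin> M} | a. a \<in> carrier A}"
    using char_kernel_maximal topspace_Max_obj
    unfolding Max_obj_def topology_generated_by_topspace topspace_char_space by auto
  fix U assume "U \<in> {{M \<in> maximal_ideals A. a \<notin> M} | a. a \<in> carrier A}"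
  then obtain a where a: "a \<in> carrier A" and U: "U = {M \<in> maximal_ideals A. a \<notin> M}" by blast
  have "char_kernel A -` U \<inter> topspace char_space = {\<psi> \<in> topspace char_space. \<psi> a \<in> - {0}}"
    using a char_kernel_maximal by (auto simp: U topspace_char_space char_kernel_def)
  also have "openin char_space \<dots>"
    using continuous_map_char_space_eval[OF a] closed_singleton_field[of 0]
    by (intro openin_continuous_map_preimage[of _ euclidean]) (simp_all add: closed_def)
  finally show "openin char_space (char_kernel A -` U \<inter> topspace char_space)" .
qed

lemma char_kernel_char_space:
  assumes "gelfand A"
  shows "char_kernel A ` topspace char_space = maximal_ideals A"
proof (intro subset_antisym subsetI)
  fix M assume M: "M \<in> maximal_ideals A"
  have "restrict (residue_value A M) (carrier A) \<in> topspace char_space"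
    using character_residue_value[OF assms M] by (simp add: topspace_char_space character_restrict)
  moreover have "char_kernel A (restrict (residue_value A M) (carrier A)) = M"
    using char_kernel_residue_value[OF assms M] by (simp add: char_kernel_restrict)
  ultimately show "M \<in> char_kernel A ` topspace char_space" by (metis imageI)
qed (auto simp: topspace_char_space char_kernel_maximal)

lemma compact_space_Max_obj:
  assumes "gelfand A" "\<And>a. a \<in> carrier A \<Longrightarrow> compact (spectrum A a)"
  shows "compact_space (Max_obj A)"
  using image_compactin[OF _ continuous_map_char_kernel, of "topspace char_space"]
    compact_space_char_space[OF assms(2)] char_kernel_char_space[OF assms(1)]
  by (simp add: compact_space_def topspace_Max_obj)

text \<open>The kernel map from the compact space of characters to the Hausdorff maximal ideal space is
  closed. Hence the function induced by \<open>a\<close>, which becomes evaluation at \<open>a\<close> on characters, has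
  closed preimages of closed sets.\<close>

lemma continuous_map_residue_value:
  assumes gelfand: "gelfand A" and "\<And>a. a \<in> carrier A \<Longrightarrow> compact (spectrum A a)"
    and "\<And>P. primeideal P A \<Longrightarrow> \<exists>!M. M \<in> maximal_ideals A \<and> P \<subseteq> M"
    and a: "a \<in> carrier A"
  shows "continuous_map (Max_obj A) euclidean (\<lambda>M. residue_value A M a)"
  unfolding continuous_map_closedin
proof (intro conjI allI impI)
  fix D :: "'f set" assume D: "closedin euclidean D"
  have closed_map: "closed_map char_space (Max_obj A) (char_kernel A)"
    by (intro continuous_imp_closed_map continuous_map_char_kernel compact_space_char_space
        Hausdorff_space_Max_obj assms)
  have "closedin char_space {\<psi> \<in> topspace char_space. \<psi> a \<in> D}"
    by (rule closedin_continuous_map_preimage[OF continuous_map_char_space_eval[OF a] D])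
  then have "closedin (Max_obj A) (char_kernel A ` {\<psi> \<in> topspace char_space. \<psi> a \<in> D})"
    using closed_map by (simp add: closed_map_def)
  also have "char_kernel A ` {\<psi> \<in> topspace char_space. \<psi> a \<in> D} =
      {M \<in> topspace (Max_obj A). residue_value A M a \<in> D}"
  proof -
    have *: "residue_value A (char_kernel A \<psi>) a = \<psi> a" if "\<psi> \<in> topspace char_space" for \<psi>
      using that residue_value_char_kernel a by (simp add: topspace_char_space)
    show ?thesis
      unfolding topspace_Max_obj char_kernel_char_space[OF gelfand, symmetric]
      using * by force
  qed
  finally show "closedin (Max_obj A) {M \<in> topspace (Max_obj A). residue_value A M a \<in> D}" .
qed simp

end

text \<open>A closed set misses some basic neighbourhood \<open>{N. a \<notin> N}\<close> of \<open>M\<close>; the function induced by \<open>a\<close>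
  then vanishes on it, and it remains to rescale its value at \<open>M\<close>.\<close>

lemma KH_obj_Max_obj:
  fixes A :: "('f::topological_field, 'a) module"
  assumes "GA_obj A"
  shows "KH_obj TYPE('f) (Max_obj A)"
proof -
  interpret F_alg A using assms by unfold_locales (simp add: GA_obj_def)
  have gelfand: "gelfand A" and cpt: "\<And>a. a \<in> carrier A \<Longrightarrow> compact (spectrum A a)"
    and pm: "\<And>P. primeideal P A \<Longrightarrow> \<exists>!M. M \<in> maximal_ideals A \<and> P \<subseteq> M"
    using assms by (simp_all add: GA_obj_def)
  have "\<exists>f :: 'a set \<Rightarrow> 'f. continuous_map (Max_obj A) euclidean f \<and> f M = 1 \<and> (\<forall>c\<in>C. f c = 0)"
    if C: "closedin (Max_obj A) C" "M \<in> topspace (Max_obj A) - C" for C M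
  proof -
    have "openin (Max_obj A) (topspace (Max_obj A) - C)" using C(1) by blast
    then obtain a where a: "a \<in> carrier A" "a \<notin> M"
      "\<And>N. N \<in> maximal_ideals A \<Longrightarrow> a \<notin> N \<Longrightarrow> N \<in> topspace (Max_obj A) - C"
      using openin_Max_obj_basicD[OF _ C(2)] by blast
    have M: "M \<in> maximal_ideals A" using C(2) by (simp add: topspace_Max_obj)
    have val: "residue_value A N a = 0 \<longleftrightarrow> a \<in> N" if "N \<in> maximal_ideals A" for N
      using char_kernel_residue_value[OF gelfand that] a(1) by (auto simp: char_kernel_def)
    define f where "f N = inverse (residue_value A M a) * residue_value A N a" for N
    have "continuous_map (Max_obj A) euclidean f"
      unfolding f_def
      by (intro continuous_map_field_mult continuous_map_residue_value gelfand cpt pm a) simp_all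
    moreover have "f M = 1" using val[OF M] a(2) by (simp add: f_def)
    moreover have "f N = 0" if "N \<in> C" for N
    proof -
      have N: "N \<in> maximal_ideals A" using closedin_subset[OF C(1)] that by (auto simp: topspace_Max_obj)
      then show ?thesis using a(3)[OF N] that val[OF N] by (auto simp: f_def)
    qed
    ultimately show ?thesis by blast
  qed
  then show ?thesis
    using compact_space_Max_obj[OF gelfand cpt] Hausdorff_imp_t1_space[OF Hausdorff_space_Max_obj[OF pm]]
    by (simp add: KH_obj_def F_Tychonoff_def)
qed

section \<open>Algebras of continuous functions\<close>

context F_alg
begin

lemma a_inv_eq_smult: 
  assumes "a \<in> carrier A" shows "\<ominus> a = (-1) \<odot>\<^bsub>A\<^esub> a"
proof (rule M.minus_equality)
  have "(-1) \<odot>\<^bsub>A\<^esub> a \<oplus> 1 \<odot>\<^bsub>A\<^esub> a = (-1 + 1) \<odot>\<^bsub>A\<^esub> a"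
    using smult_l_distr[of "-1" 1 a] assms by simp
  moreover have "1 \<odot>\<^bsub>A\<^esub> a = a" using smult_one[OF assms] by simp
  moreover have "(-1 + 1) \<odot>\<^bsub>A\<^esub> a = \<zero>" using smult_l_null[OF assms] by simp
  ultimately show "(-1) \<odot>\<^bsub>A\<^esub> a \<oplus> a = \<zero>" by simp
qed (use assms in simp_all)

lemma F_subalgebraI:
  assumes "B \<subseteq> carrier A" "\<one> \<in> B"
    and add: "\<And>a b. a \<in> B \<Longrightarrow> b \<in> B \<Longrightarrow> a \<oplus> b \<in> B"
    and mult: "\<And>a b. a \<in> B \<Longrightarrow> b \<in> B \<Longrightarrow> a \<otimes> b \<in> B"
    and smult: "\<And>k a. a \<in> B \<Longrightarrow> k \<odot>\<^bsub>A\<^esub> a \<in> B"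
  shows "F_subalgebra B A"
  unfolding F_subalgebra_def
proof
  have neg: "\<ominus> a \<in> B" if "a \<in> B" for a
    using a_inv_eq_smult[of a] that smult[OF that] assms(1) by auto
  have "\<one> \<oplus> \<ominus> \<one> \<in> B" using add neg assms(2) by blast
  then have zero: "\<zero> \<in> B" by (simp add: M.r_neg)
  show "submodule B scalars A"
    by (rule submoduleI) (use assms neg zero in auto)
  show "subring B A"
    by (rule ring.subringI[OF cring.axioms(1)[OF M_cring]]) (use assms neg in auto)
qed

end

lemma C_obj_simps [simp]:
  "\<one>\<^bsub>C_obj S\<^esub> = (\<lambda>x\<in>topspace S. 1)"
  "\<zero>\<^bsub>C_obj S\<^esub> = (\<lambda>x\<in>topspace S. 0)"
  "f \<otimes>\<^bsub>C_obj S\<^esub> g = (\<lambda>x\<in>topspace S. f x * g x)"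
  "f \<oplus>\<^bsub>C_obj S\<^esub> g = (\<lambda>x\<in>topspace S. f x + g x)"
  "k \<odot>\<^bsub>C_obj S\<^esub> f = (\<lambda>x\<in>topspace S. k * f x)"
  by (simp_all add: C_obj_def)

lemma carrier_C_obj:
  "f \<in> carrier (C_obj S) \<longleftrightarrow> f \<in> extensional (topspace S) \<and> continuous_map S euclidean f"
  by (simp add: C_obj_def)

lemma continuous_map_restrict_topspace:
  "continuous_map S T (restrict f (topspace S)) \<longleftrightarrow> continuous_map S T f"
  by (rule iffI; erule continuous_map_eq; simp)

lemma restrict_in_C_obj:
  "continuous_map S euclidean f \<Longrightarrow> (\<lambda>x\<in>topspace S. f x) \<in> carrier (C_obj S)"
  by (simp add: carrier_C_obj continuous_map_restrict_topspace)

lemma C_obj_continuous: "f \<in> carrier (C_obj S) \<Longrightarrow> continuous_map S euclidean f"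
  by (simp add: carrier_C_obj)

lemma C_obj_eqI:
  assumes "f \<in> carrier (C_obj S)" "g \<in> carrier (C_obj S)" "\<And>x. x \<in> topspace S \<Longrightarrow> f x = g x"
  shows "f = g"
  using assms by (auto simp: carrier_C_obj intro: extensionalityI)

lemma C_obj_restrict: "f \<in> carrier (C_obj S) \<Longrightarrow> restrict f (topspace S) = f"
  by (simp add: carrier_C_obj extensional_restrict)

lemma C_obj_closed:
  fixes f g :: "'x \<Rightarrow> 'f::topological_field"
  assumes "f \<in> carrier (C_obj S)"
  shows "g \<in> carrier (C_obj S) \<Longrightarrow> (\<lambda>x\<in>topspace S. f x + g x) \<in> carrier (C_obj S)"
    and "g \<in> carrier (C_obj S) \<Longrightarrow> (\<lambda>x\<in>topspace S. f x * g x) \<in> carrier (C_obj S)"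
    and "(\<lambda>x\<in>topspace S. k * f x) \<in> carrier (C_obj S)"
    and "(\<lambda>x\<in>topspace S. - f x) \<in> carrier (C_obj S)"
  using assms
  by (auto dest!: C_obj_continuous intro!: restrict_in_C_obj continuous_map_field_add
      continuous_map_field_mult continuous_map_field_uminus)

lemma C_obj_const: "(\<lambda>x\<in>topspace S. k) \<in> carrier (C_obj S)"
  by (simp add: restrict_in_C_obj)

lemma F_alg_C_obj: "F_alg (C_obj S :: ('f::topological_field, 'x \<Rightarrow> 'f) module)"
proof -
  let ?A = "C_obj S :: ('f, 'x \<Rightarrow> 'f) module"
  have group: "abelian_group ?A"
  proof (rule abelian_groupI)
    fix f assume f: "f \<in> carrier ?A"
    show "\<exists>g\<in>carrier ?A. g \<oplus>\<^bsub>?A\<^esub> f = \<zero>\<^bsub>?A\<^esub>"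
      using C_obj_closed(4)[OF f] by (intro bexI[of _ "\<lambda>x\<in>topspace S. - f x"]) (auto simp: fun_eq_iff)
  qed (auto simp: C_obj_closed C_obj_const C_obj_restrict algebra_simps cong: restrict_cong)
  have monoid: "comm_monoid ?A"
    by (rule comm_monoidI)
      (auto simp: C_obj_closed C_obj_const C_obj_restrict algebra_simps cong: restrict_cong)
  have "cring ?A"
    by (rule cringI[OF group monoid]) (auto simp: algebra_simps cong: restrict_cong)
  then have "Module.algebra scalars ?A"
    by (intro algebraI cring_scalars)
      (auto simp: C_obj_closed C_obj_restrict algebra_simps cong: restrict_cong)
  then show ?thesis by unfold_locales (simp add: F_algebra_def)
qed

lemma character_evaluation:
  "x \<in> topspace S \<Longrightarrow> character (C_obj S) (\<lambda>f. f x)"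
  by (simp add: character_def)

lemma point_ideal_eq_char_kernel:
  "x \<in> topspace S \<Longrightarrow> point_ideal S x = char_kernel (C_obj S) (\<lambda>f. f x)"
  by (simp add: point_ideal_def char_kernel_def)

lemma point_ideal_maximal: "x \<in> topspace S \<Longrightarrow> point_ideal S x \<in> maximal_ideals (C_obj S)"
  by (simp add: point_ideal_eq_char_kernel F_alg.char_kernel_maximal F_alg_C_obj character_evaluation)

lemma residue_value_point_ideal:
  assumes "x \<in> topspace S" "f \<in> carrier (C_obj S)"
  shows "residue_value (C_obj S) (point_ideal S x) f = f x"
  unfolding point_ideal_eq_char_kernel[OF assms(1)]
  by (rule F_alg.residue_value_char_kernel[OF F_alg_C_obj character_evaluation[OF assms(1)] assms(2)])

lemma nowhere_zero_Unit:
  fixes f :: "'x \<Rightarrow> 'f::topological_field"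
  assumes f: "f \<in> carrier (C_obj S)" and "\<And>x. x \<in> topspace S \<Longrightarrow> f x \<noteq> 0"
  shows "f \<in> Units (C_obj S)"
proof -
  define g where "g = (\<lambda>x\<in>topspace S. inverse (f x))"
  have "g \<in> carrier (C_obj S)"
    unfolding g_def using assms by (intro restrict_in_C_obj continuous_map_field_inverse C_obj_continuous)
  moreover have "g \<otimes>\<^bsub>C_obj S\<^esub> f = \<one>\<^bsub>C_obj S\<^esub>" "f \<otimes>\<^bsub>C_obj S\<^esub> g = \<one>\<^bsub>C_obj S\<^esub>"
    using assms(2) by (auto simp: g_def fun_eq_iff)
  ultimately show ?thesis using f unfolding Units_def by blast
qed

lemma C_obj_Units_iff:
  fixes f :: "'x \<Rightarrow> 'f::topological_field"
  assumes f: "f \<in> carrier (C_obj S)"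
  shows "f \<in> Units (C_obj S) \<longleftrightarrow> (\<forall>x\<in>topspace S. f x \<noteq> 0)"
proof (intro iffI ballI)
  fix x assume "f \<in> Units (C_obj S)" and x: "x \<in> topspace S"
  then obtain g where "g \<otimes>\<^bsub>C_obj S\<^esub> f = \<one>\<^bsub>C_obj S\<^esub>" unfolding Units_def by blast
  then have "(g \<otimes>\<^bsub>C_obj S\<^esub> f) x = 1" using x by simp
  then show "f x \<noteq> 0" using x by auto
qed (rule nowhere_zero_Unit[OF f], blast)

section \<open>Ideals of functions without common zeros\<close>

text \<open>A continuous function with the values \<open>1\<close> and \<open>0\<close> at two given points pulls disjoint
  neighbourhoods of \<open>1\<close> and \<open>0\<close> back to disjoint neighbourhoods of these points.\<close>

lemma Hausdorff_F_Tychonoff: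
  assumes "F_Tychonoff TYPE('f::topological_field) S"
  shows "Hausdorff_space S"
  unfolding Hausdorff_space_def
proof (intro allI impI)
  fix x y assume xy: "x \<in> topspace S \<and> y \<in> topspace S \<and> x \<noteq> y"
  have "t1_space S" using assms by (simp add: F_Tychonoff_def)
  then have "closedin S {y}" using xy by (simp add: t1_space_closedin_singleton)
  then obtain f :: "'a \<Rightarrow> 'f" where f: "continuous_map S euclidean f" "f x = 1" "f y = 0"
    using assms xy unfolding F_Tychonoff_def by (metis Diff_iff singletonI singletonD)
  obtain U V where UV: "open U" "open V" "(1::'f) \<in> U" "(0::'f) \<in> V" "disjnt U V"
    using Hausdorff_topological_field[where 'f='f] unfolding Hausdorff_space_def
    by (metis open_openin topspace_euclidean UNIV_I zero_neq_one)
  show "\<exists>U V. openin S U \<and> openin S V \<and> x \<in> U \<and> y \<in> V \<and> disjnt U V"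
    using UV f xy openin_continuous_map_preimage[OF f(1)]
    by (intro exI[of _ "{z \<in> topspace S. f z \<in> U}"] exI[of _ "{z \<in> topspace S. f z \<in> V}"])
      (auto simp: disjnt_iff)
qed

lemma F_Tychonoff_separates:
  fixes S :: "'x topology"
  assumes "F_Tychonoff TYPE('f::topological_field) S" "closedin S C" "x \<in> topspace S" "x \<notin> C"
  obtains f :: "'x \<Rightarrow> 'f::topological_field" where "f \<in> carrier (C_obj S)" "f x = 1" "\<And>c. c \<in> C \<Longrightarrow> f c = 0"
proof -
  obtain f :: "'x \<Rightarrow> 'f" where f: "continuous_map S euclidean f" "f x = 1" "\<forall>c\<in>C. f c = 0"
    using assms unfolding F_Tychonoff_def by blast
  show ?thesis
  proof
    show "(\<lambda>x\<in>topspace S. f x) \<in> carrier (C_obj S)" by (rule restrict_in_C_obj[OF f(1)])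
  qed (use f(2,3) assms(3) closedin_subset[OF assms(2)] in auto)
qed

text \<open>The zero sets of the members of a directed family with empty intersection are closed subsets
  of a compact space, so one of them is already empty.\<close>

lemma directed_family_nowhere_zero:
  fixes I :: "('x \<Rightarrow> 'f::topological_field) set"
  assumes "compact_space S" and "I \<noteq> {}"
    and cont: "\<And>f. f \<in> I \<Longrightarrow> continuous_map S euclidean f"
    and no_zero: "\<And>x. x \<in> topspace S \<Longrightarrow> \<exists>f\<in>I. f x \<noteq> 0"
    and directed: "\<And>f g. f \<in> I \<Longrightarrow> g \<in> I \<Longrightarrow> \<exists>h\<in>I. \<forall>x\<in>topspace S. h x = 0 \<longrightarrow> f x = 0 \<and> g x = 0"
  obtains f where "f \<in> I" "\<And>x. x \<in> topspace S \<Longrightarrow> f x \<noteq> 0"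
proof -
  define D where "D f = {x \<in> topspace S. f x \<noteq> 0}" for f :: "'x \<Rightarrow> 'f"
  have "openin S (D f)" if "f \<in> I" for f
  proof -
    have "openin S {x \<in> topspace S. f x \<in> - {0}}"
      using closed_singleton_field[of "0::'f"]
      by (intro openin_continuous_map_preimage[OF cont[OF that]]) (simp add: closed_def)
    then show ?thesis by (simp add: D_def)
  qed
  moreover have "topspace S \<subseteq> \<Union>(D ` I)" using no_zero by (auto simp: D_def)
  ultimately obtain \<F> where "finite \<F>" "\<F> \<subseteq> D ` I" "topspace S \<subseteq> \<Union>\<F>"
    using assms(1) unfolding compact_space_alt by (metis (no_types, lifting) imageE)
  then obtain J where J: "finite J" "J \<subseteq> I" "topspace S \<subseteq> \<Union>(D ` J)"
    by (metis finite_subset_image)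
  have "\<exists>h\<in>I. \<forall>x\<in>topspace S. h x = 0 \<longrightarrow> (\<forall>f\<in>J. f x = 0)"
    using J(1,2)
  proof induction
    case empty
    then show ?case using assms(2) by auto
  next
    case (insert g J)
    then obtain h where h: "h \<in> I" "\<forall>x\<in>topspace S. h x = 0 \<longrightarrow> (\<forall>f\<in>J. f x = 0)" by auto
    obtain k where k: "k \<in> I" "\<forall>x\<in>topspace S. k x = 0 \<longrightarrow> g x = 0 \<and> h x = 0"
      using directed[of g h] h(1) insert.prems by auto
    have "\<forall>x\<in>topspace S. k x = 0 \<longrightarrow> (\<forall>f\<in>insert g J. f x = 0)"
      using k(2) h(2) by blast
    with k(1) show ?case by blast
  qed
  then obtain h where h: "h \<in> I" "\<forall>x\<in>topspace S. h x = 0 \<longrightarrow> (\<forall>f\<in>J. f x = 0)" by blast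
  have "h x \<noteq> 0" if x: "x \<in> topspace S" for x
  proof -
    obtain f where "f \<in> J" "f x \<noteq> 0" using J(3) x by (auto simp: D_def)
    with h(2) x show ?thesis by blast
  qed
  with h(1) show ?thesis by (rule that)
qed

lemma complex_identification_facts:
  fixes \<phi> :: "'f::topological_field \<Rightarrow> complex"
  assumes "complex_identification \<phi>"
  shows "\<phi> (x + y) = \<phi> x + \<phi> y" "\<phi> (x * y) = \<phi> x * \<phi> y" "\<phi> x = 0 \<longleftrightarrow> x = 0"
    "\<phi> (inv_into UNIV \<phi> z) = z" "\<phi> x = \<phi> y \<longleftrightarrow> x = y"
    "continuous_map euclidean euclidean \<phi>" "continuous_map euclidean euclidean (inv_into UNIV \<phi>)"
proof -
  have bij: "bij \<phi>" and add: "\<And>x y. \<phi> (x + y) = \<phi> x + \<phi> y"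
    using assms by (simp_all add: complex_identification_def)
  show "\<phi> (x + y) = \<phi> x + \<phi> y" "\<phi> (x * y) = \<phi> x * \<phi> y"
    "continuous_map euclidean euclidean \<phi>" "continuous_map euclidean euclidean (inv_into UNIV \<phi>)"
    using assms by (simp_all add: complex_identification_def)
  show inj: "\<phi> x = \<phi> y \<longleftrightarrow> x = y" for x y using bij by (simp add: bij_def inj_eq)
  have "\<phi> 0 = 0" using add[of 0 0] by simp
  then show "\<phi> x = 0 \<longleftrightarrow> x = 0" using inj[of x 0] by simp
  show "\<phi> (inv_into UNIV \<phi> z) = z" using bij by (simp add: bij_def surj_f_inv_f)
qed

lemma conjugate_in_C_obj:
  fixes \<phi> :: "'f::topological_field \<Rightarrow> complex"
  assumes \<phi>: "complex_identification \<phi>" and f: "f \<in> carrier (C_obj S)"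
  shows "(\<lambda>x\<in>topspace S. inv_into UNIV \<phi> (cnj (\<phi> (f x)))) \<in> carrier (C_obj S)"
proof (rule restrict_in_C_obj)
  have "continuous_map euclidean euclidean cnj"
    using continuous_on_cnj[OF continuous_on_id, of UNIV] by simp
  note c = continuous_map_compose[OF continuous_map_compose[OF continuous_map_compose[OF
      C_obj_continuous[OF f] complex_identification_facts(6)[OF \<phi>]] this]
      complex_identification_facts(7)[OF \<phi>]]
  show "continuous_map S euclidean (\<lambda>x. inv_into UNIV \<phi> (cnj (\<phi> (f x))))"
    using c by (simp add: o_def)
qed

text \<open>The zero set of \<open>f cnj f + g cnj g\<close> is the intersection of the zero sets of \<open>f\<close> and \<open>g\<close>.\<close>

lemma nowhere_zero_in_ideal_complex:
  fixes \<phi> :: "'f::topological_field \<Rightarrow> complex"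
  assumes \<phi>: "complex_identification \<phi>" and "compact_space S"
    and I: "ideal I (C_obj S :: ('f, 'x \<Rightarrow> 'f) module)"
    and no_zero: "\<And>x. x \<in> topspace S \<Longrightarrow> \<exists>f\<in>I. f x \<noteq> 0"
  obtains f where "f \<in> I" "\<And>x. x \<in> topspace S \<Longrightarrow> f x \<noteq> 0"
proof (rule directed_family_nowhere_zero[OF assms(2) _ _ no_zero])
  interpret I: ideal I "C_obj S :: ('f, 'x \<Rightarrow> 'f) module" by fact
  show "I \<noteq> {}" using additive_subgroup.zero_closed[OF ideal.axioms(1)[OF I]] by blast
  show "continuous_map S euclidean f" if "f \<in> I" for f
    using I.Icarr[OF that] by (rule C_obj_continuous)
  fix f g assume fg: "f \<in> I" "g \<in> I"
  define bar where "bar f = (\<lambda>x\<in>topspace S. inv_into UNIV \<phi> (cnj (\<phi> (f x))))" for f :: "'x \<Rightarrow> 'f"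
  have bar: "bar f \<in> carrier (C_obj S)" if "f \<in> I" for f
    unfolding bar_def by (rule conjugate_in_C_obj[OF \<phi> I.Icarr[OF that]])
  define h where "h = (f \<otimes>\<^bsub>C_obj S\<^esub> bar f) \<oplus>\<^bsub>C_obj S\<^esub> (g \<otimes>\<^bsub>C_obj S\<^esub> bar g)"
  have "h \<in> I"
    unfolding h_def by (intro additive_subgroup.a_closed[OF ideal.axioms(1)[OF I]] I.I_r_closed bar fg)
  moreover have "f x = 0 \<and> g x = 0" if x: "x \<in> topspace S" "h x = 0" for x
  proof -
    note facts = complex_identification_facts[OF \<phi>]
    have "\<phi> (h x) = \<phi> (f x) * cnj (\<phi> (f x)) + \<phi> (g x) * cnj (\<phi> (g x))"
      using x(1) by (simp add: h_def bar_def facts)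
    also have "\<dots> = of_real ((cmod (\<phi> (f x)))\<^sup>2 + (cmod (\<phi> (g x)))\<^sup>2)"
      by (simp only: of_real_add complex_norm_square)
    finally have "(cmod (\<phi> (f x)))\<^sup>2 + (cmod (\<phi> (g x)))\<^sup>2 = 0"
      using x(2) facts(3)[of 0] by (metis of_real_eq_0_iff)
    then show ?thesis by (simp add: sum_power2_eq_zero_iff facts(3))
  qed
  ultimately show "\<exists>h\<in>I. \<forall>x\<in>topspace S. h x = 0 \<longrightarrow> f x = 0 \<and> g x = 0" by blast
qed (assumption, erule that, simp)

text \<open>On a discrete space the indicator \<open>e\<close> of the zero set of \<open>f\<close> is continuous, and \<open>f + g e\<close>
  vanishes only at common zeros of \<open>f\<close> and \<open>g\<close>.\<close>

lemma nowhere_zero_in_ideal_finite: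
  assumes "finite (topspace S)" "t1_space S"
    and I: "ideal I (C_obj S :: ('f::topological_field, 'x \<Rightarrow> 'f) module)"
    and no_zero: "\<And>x. x \<in> topspace S \<Longrightarrow> \<exists>f\<in>I. f x \<noteq> 0"
  obtains f where "f \<in> I" "\<And>x. x \<in> topspace S \<Longrightarrow> f x \<noteq> 0"
proof (rule directed_family_nowhere_zero[OF _ _ _ no_zero])
  interpret I: ideal I "C_obj S :: ('f, 'x \<Rightarrow> 'f) module" by fact
  have discrete: "S = discrete_topology (topspace S)"
    by (rule finite_t1_space_imp_discrete_topology[OF refl assms(1,2)])
  show "compact_space S"
    by (subst discrete) (simp add: compact_space_discrete_topology assms(1))
  show "I \<noteq> {}" using additive_subgroup.zero_closed[OF ideal.axioms(1)[OF I]] by blast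
  show "continuous_map S euclidean f" if "f \<in> I" for f
    using I.Icarr[OF that] by (rule C_obj_continuous)
  fix f g assume fg: "f \<in> I" "g \<in> I"
  define e where "e = (\<lambda>x\<in>topspace S. if f x = 0 then 1 else 0 :: 'f)"
  have "e \<in> carrier (C_obj S)"
    unfolding e_def by (rule restrict_in_C_obj) (subst discrete, simp)
  then have "f \<oplus>\<^bsub>C_obj S\<^esub> (g \<otimes>\<^bsub>C_obj S\<^esub> e) \<in> I"
    using fg by (intro additive_subgroup.a_closed[OF ideal.axioms(1)[OF I]] I.I_r_closed)
  moreover have "f x = 0 \<and> g x = 0"
    if "x \<in> topspace S" "(f \<oplus>\<^bsub>C_obj S\<^esub> (g \<otimes>\<^bsub>C_obj S\<^esub> e)) x = 0" for x
    using that by (auto simp: e_def split: if_splits)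
  ultimately show "\<exists>h\<in>I. \<forall>x\<in>topspace S. h x = 0 \<longrightarrow> f x = 0 \<and> g x = 0" by blast
qed (assumption, erule that, simp)

text \<open>The disjoint union of \<open>S\<close> and one isolated point \<open>p\<close>, with underlying set inside the type of
  the points of \<open>S\<close>: the points of \<open>S\<close> are moved out of the way by an injection \<open>h\<close> that misses
  \<open>p\<close>.\<close>

definition add_point :: "('x \<Rightarrow> 'x) \<Rightarrow> 'x \<Rightarrow> 'x topology \<Rightarrow> 'x topology" where
  "add_point h p S =
     topology (\<lambda>U. U \<subseteq> insert p (h ` topspace S) \<and> openin S {x \<in> topspace S. h x \<in> U})"

lemma openin_add_point:
  "openin (add_point h p S) U \<longleftrightarrow>
     U \<subseteq> insert p (h ` topspace S) \<and> openin S {x \<in> topspace S. h x \<in> U}"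
proof -
  have "istopology (\<lambda>U. U \<subseteq> insert p (h ` topspace S) \<and> openin S {x \<in> topspace S. h x \<in> U})"
    unfolding istopology_def
  proof (intro conjI allI impI)
    fix U V
    assume "U \<subseteq> insert p (h ` topspace S) \<and> openin S {x \<in> topspace S. h x \<in> U}"
      "V \<subseteq> insert p (h ` topspace S) \<and> openin S {x \<in> topspace S. h x \<in> V}"
    moreover have "{x \<in> topspace S. h x \<in> U \<inter> V} =
        {x \<in> topspace S. h x \<in> U} \<inter> {x \<in> topspace S. h x \<in> V}" by blast
    ultimately show "U \<inter> V \<subseteq> insert p (h ` topspace S)" "openin S {x \<in> topspace S. h x \<in> U \<inter> V}"
      by auto
  next
    fix \<K>
    assume \<K>: "\<forall>U\<in>\<K>. U \<subseteq> insert p (h ` topspace S) \<and> openin S {x \<in> topspace S. h x \<in> U}"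
    then show "\<Union>\<K> \<subseteq> insert p (h ` topspace S)" by blast
    have "{x \<in> topspace S. h x \<in> \<Union>\<K>} = \<Union>((\<lambda>U. {x \<in> topspace S. h x \<in> U}) ` \<K>)" by blast
    then show "openin S {x \<in> topspace S. h x \<in> \<Union>\<K>}" using \<K> by auto
  qed
  then show ?thesis by (simp add: add_point_def)
qed

lemma topspace_add_point: "topspace (add_point h p S) = insert p (h ` topspace S)"
proof (rule subset_antisym)
  show "topspace (add_point h p S) \<subseteq> insert p (h ` topspace S)"
    using openin_add_point[THEN iffD1, OF openin_topspace] by (rule conjunct1)
  have "{x \<in> topspace S. h x \<in> insert p (h ` topspace S)} = topspace S" by blast
  then have "openin (add_point h p S) (insert p (h ` topspace S))"
    by (simp add: openin_add_point)
  then show "insert p (h ` topspace S) \<subseteq> topspace (add_point h p S)"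
    by (rule openin_subset)
qed

lemma continuous_map_into_add_point: "continuous_map S (add_point h p S) h"
  unfolding continuous_map_def topspace_add_point by (auto simp: openin_add_point)

lemma continuous_map_from_add_point:
  fixes g :: "'x \<Rightarrow> 'f::topological_field"
  assumes "continuous_map S euclidean (\<lambda>x. g (h x))"
  shows "continuous_map (add_point h p S) euclidean g"
  unfolding continuous_map_def topspace_add_point
proof (intro conjI allI impI)
  fix U :: "'f set" assume U: "openin euclidean U"
  have "{x \<in> topspace S. h x \<in> {z \<in> insert p (h ` topspace S). g z \<in> U}} = {x \<in> topspace S. g (h x) \<in> U}"
    by blast
  then show "openin (add_point h p S) {z \<in> insert p (h ` topspace S). g z \<in> U}"
    using openin_continuous_map_preimage[OF assms U] unfolding openin_add_point by auto
qed simp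

lemma compact_space_add_point:
  assumes "compact_space S"
  shows "compact_space (add_point h p S)"
proof -
  have "compactin (add_point h p S) (h ` topspace S)"
    using assms image_compactin[OF _ continuous_map_into_add_point] by (simp add: compact_space_def)
  moreover have "compactin (add_point h p S) {p}" by (simp add: topspace_add_point)
  ultimately have "compactin (add_point h p S) ({p} \<union> h ` topspace S)" by (intro compactin_Un)
  then show ?thesis by (simp add: compact_space_def topspace_add_point)
qed

lemma Hausdorff_space_add_point:
  assumes "Hausdorff_space S" "inj h" "p \<notin> range h"
  shows "Hausdorff_space (add_point h p S)"
  unfolding Hausdorff_space_def topspace_add_point
proof (intro allI impI)
  have im: "openin (add_point h p S) (h ` U)" if "openin S U" for U
  proof -
    have "{x \<in> topspace S. h x \<in> h ` U} = U"
      using openin_subset[OF that] assms(2) by (auto simp: inj_image_mem_iff)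
    then show ?thesis using that openin_subset[OF that] by (auto simp: openin_add_point)
  qed
  have "{x \<in> topspace S. h x \<in> {p}} = {}" using assms(3) by auto
  then have single: "openin (add_point h p S) {p}"
    unfolding openin_add_point by (metis empty_subsetI insert_mono openin_empty)
  have disj: "disjnt {p} (h ` U)" for U using assms(3) by (auto simp: disjnt_def)
  fix z w assume zw: "z \<in> insert p (h ` topspace S) \<and> w \<in> insert p (h ` topspace S) \<and> z \<noteq> w"
  then consider "z = p" "w \<in> h ` topspace S" | "w = p" "z \<in> h ` topspace S"
    | x y where "x \<in> topspace S" "y \<in> topspace S" "z = h x" "w = h y" "x \<noteq> y"
    by (elim conjE insertE imageE) auto
  then show "\<exists>U V. openin (add_point h p S) U \<and> openin (add_point h p S) V \<and> z \<in> U \<and> w \<in> V \<and> disjnt U V"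
  proof cases
    case 1
    then show ?thesis using single im[OF openin_topspace] disj[of "topspace S"]
      by (intro exI[of _ "{p}"] exI[of _ "h ` topspace S"]) simp
  next
    case 2
    then show ?thesis using single im[OF openin_topspace] disj[of "topspace S"]
      by (intro exI[of _ "h ` topspace S"] exI[of _ "{p}"]) (simp add: disjnt_sym)
  next
    case 3
    then obtain U V where UV: "openin S U" "openin S V" "x \<in> U" "y \<in> V" "disjnt U V"
      using assms(1) unfolding Hausdorff_space_def by metis
    then have "disjnt (h ` U) (h ` V)" using assms(2) by (auto simp: disjnt_def dest: injD)
    then show ?thesis using 3 UV im
      by (intro exI[of _ "h ` U"] exI[of _ "h ` V"]) simp
  qed
qed

text \<open>Extend the functions of an ideal \<open>I\<close> by zero to an additional isolated point \<open>p\<close> and add the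
  constants: this is a subalgebra, which separates points if \<open>I\<close> has no common zero. By the
  Stone-Weierstrass theorem it contains a function close to \<open>0\<close> at \<open>p\<close> and close to \<open>1\<close> on the
  rest. Subtracting its value at \<open>p\<close> leaves a member of \<open>I\<close> close to \<open>1\<close> everywhere.\<close>

lemma nowhere_zero_in_ideal_infinite:
  fixes S :: "'x topology" and I :: "('x \<Rightarrow> 'f::topological_field) set"
  assumes sw: "stone_weierstrass TYPE('f) TYPE('x)"
    and no_complex: "\<And>\<phi> :: 'f \<Rightarrow> complex. \<not> complex_identification \<phi>"
    and infinite: "infinite (UNIV :: 'x set)"
    and S: "KH_obj TYPE('f) S"
    and I: "ideal I (C_obj S :: ('f, 'x \<Rightarrow> 'f) module)"
    and no_zero: "\<And>x. x \<in> topspace S \<Longrightarrow> \<exists>f\<in>I. f x \<noteq> 0"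
  obtains f where "f \<in> I" "\<And>x. x \<in> topspace S \<Longrightarrow> f x \<noteq> 0"
proof -
  let ?A = "C_obj S :: ('f, 'x \<Rightarrow> 'f) module"
  interpret I: ideal I ?A by fact
  note I_add = additive_subgroup.a_closed[OF ideal.axioms(1)[OF I]]
  have Tych: "F_Tychonoff TYPE('f) S" and cpt: "compact_space S"
    using S by (simp_all add: KH_obj_def)
  have Haus: "Hausdorff_space S" by (rule Hausdorff_F_Tychonoff[OF Tych])
  obtain h :: "'x \<Rightarrow> 'x" and p0 where "bij_betw h UNIV (UNIV - {p0})"
    using infinite_imp_bij_betw[OF infinite, of undefined] by blast
  then have h: "inj h" "p0 \<notin> range h" by (auto simp: bij_betw_def)
  define T where "T = add_point h p0 S"
  let ?B = "C_obj T :: ('f, 'x \<Rightarrow> 'f) module"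
  have top_T: "topspace T = insert p0 (h ` topspace S)" by (simp add: T_def topspace_add_point)
  have T: "compact_space T" "Hausdorff_space T"
    unfolding T_def using compact_space_add_point[OF cpt] Hausdorff_space_add_point[OF Haus h] by simp_all
  define pull where "pull g = (\<lambda>x\<in>topspace S. g (h x))" for g :: "'x \<Rightarrow> 'f"
  have pull: "pull g \<in> carrier ?A" if "g \<in> carrier ?B" for g
  proof -
    have "continuous_map S euclidean (g \<circ> h)"
      using continuous_map_into_add_point C_obj_continuous[OF that] unfolding T_def
      by (rule continuous_map_compose)
    then show ?thesis unfolding pull_def by (intro restrict_in_C_obj) (simp add: o_def)
  qed
  \<comment> \<open>\<open>B\<close> consists of the members of \<open>I\<close>, extended by zero to \<open>p0\<close>, plus constants; the constant is the
    value at \<open>p0\<close>, and \<open>r g\<close> recovers the member of \<open>I\<close>.\<close>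
  define r where "r g = (\<lambda>x\<in>topspace S. g (h x) - g p0)" for g :: "'x \<Rightarrow> 'f"
  define B where "B = {g \<in> carrier ?B. r g \<in> I}"
  have ext: "(\<lambda>z\<in>topspace T. if z = p0 then 0 else f (inv_into UNIV h z)) \<in> B" (is "?e \<in> B") if "f \<in> I" for f
  proof -
    have f: "f \<in> carrier ?A" using I.Icarr[OF that] .
    have eq: "(if h x = p0 then 0 else f (inv_into UNIV h (h x))) = f x" for x
      using h by auto
    have "?e \<in> carrier ?B"
      unfolding T_def
      by (intro restrict_in_C_obj continuous_map_from_add_point) (simp only: eq C_obj_continuous[OF f])
    moreover have "r ?e = f"
    proof (rule C_obj_eqI[OF _ f])
      show "r ?e x = f x" if "x \<in> topspace S" for x
        using that h by (auto simp: r_def top_T)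
      then have "r ?e = restrict f (topspace S)" by (auto simp: r_def)
      then show "r ?e \<in> carrier ?A" using f by (simp add: C_obj_restrict)
    qed
    ultimately show ?thesis using that by (simp add: B_def)
  qed
  have "F_subalgebra B ?B"
  proof (rule F_alg.F_subalgebraI[OF F_alg_C_obj])
    show "B \<subseteq> carrier ?B" by (auto simp: B_def)
    have "r \<one>\<^bsub>?B\<^esub> = \<zero>\<^bsub>?A\<^esub>" by (auto simp: r_def top_T)
    then show "\<one>\<^bsub>?B\<^esub> \<in> B"
      using additive_subgroup.zero_closed[OF ideal.axioms(1)[OF I]] C_obj_const[of 1 T] by (simp add: B_def)
    fix f g assume "f \<in> B" "g \<in> B"
    then have fg: "f \<in> carrier ?B" "g \<in> carrier ?B" "r f \<in> I" "r g \<in> I" by (simp_all add: B_def)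
    have "r (f \<oplus>\<^bsub>?B\<^esub> g) = r f \<oplus>\<^bsub>?A\<^esub> r g" by (auto simp: r_def top_T)
    then show "f \<oplus>\<^bsub>?B\<^esub> g \<in> B" using I_add[OF fg(3,4)] C_obj_closed(1)[OF fg(1,2)] by (simp add: B_def)
    have "r (f \<otimes>\<^bsub>?B\<^esub> g) = (pull f \<otimes>\<^bsub>?A\<^esub> r g) \<oplus>\<^bsub>?A\<^esub> ((\<lambda>x\<in>topspace S. g p0) \<otimes>\<^bsub>?A\<^esub> r f)"
      by (auto simp: r_def pull_def top_T algebra_simps)
    moreover have "\<dots> \<in> I"
      by (intro I_add I.I_l_closed fg pull C_obj_const)
    ultimately show "f \<otimes>\<^bsub>?B\<^esub> g \<in> B" using C_obj_closed(2)[OF fg(1,2)] by (simp add: B_def)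
  next
    fix k g assume "g \<in> B"
    then have g: "g \<in> carrier ?B" "r g \<in> I" by (simp_all add: B_def)
    have "r (k \<odot>\<^bsub>?B\<^esub> g) = (\<lambda>x\<in>topspace S. k) \<otimes>\<^bsub>?A\<^esub> r g"
      by (auto simp: r_def top_T algebra_simps)
    moreover have "\<dots> \<in> I" by (intro I.I_l_closed g C_obj_const)
    ultimately show "k \<odot>\<^bsub>?B\<^esub> g \<in> B" using C_obj_closed(3)[OF g(1)] by (simp add: B_def)
  qed
  moreover have "separates_points T B"
    unfolding separates_points_def
  proof (intro ballI impI)
    have at_p: "\<exists>g\<in>B. g p0 \<noteq> g (h x)" if x: "x \<in> topspace S" for x
    proof -
      obtain f where "f \<in> I" "f x \<noteq> 0" using no_zero[OF x] by blast
      then show ?thesis using ext[of f] h x by (intro bexI[OF _ ext]) (auto simp: top_T)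
    qed
    fix z w assume zw: "z \<in> topspace T" "w \<in> topspace T" "z \<noteq> w"
    then consider x where "z = p0" "w = h x" "x \<in> topspace S"
      | x where "w = p0" "z = h x" "x \<in> topspace S"
      | x y where "x \<in> topspace S" "y \<in> topspace S" "z = h x" "w = h y" "x \<noteq> y"
      unfolding top_T by (elim insertE imageE) auto
    then show "\<exists>g\<in>B. g z \<noteq> g w"
    proof cases
      case 1 then show ?thesis using at_p by simp
    next
      case 2 then show ?thesis using at_p[OF 2(3)] by (metis (no_types))
    next
      case 3
      obtain f where f: "f \<in> I" "f x \<noteq> 0" using no_zero[OF 3(1)] by blast
      have "closedin S {y}" using closedin_Hausdorff_singleton[OF Haus 3(2)] .
      then obtain u :: "'x \<Rightarrow> 'f" where u: "u \<in> carrier ?A" "u x = 1" "u y = 0"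
        using F_Tychonoff_separates[OF Tych _ 3(1), of "{y}"] 3(5) by blast
      have "f \<otimes>\<^bsub>?A\<^esub> u \<in> I" by (rule I.I_r_closed[OF f(1) u(1)])
      then show ?thesis
        using h 3 f u by (intro bexI[OF _ ext[of "f \<otimes>\<^bsub>?A\<^esub> u"]]) (auto simp: top_T)
    qed
  qed
  ultimately have dense: "uniformly_dense T B"
    using sw T no_complex unfolding stone_weierstrass_def by blast
  obtain U :: "'f set" where U: "U \<in> symmetric_nbhds_0" "1 \<notin> U"
    using symmetric_nbhd_avoiding[of "1::'f"] by auto
  obtain V where V: "V \<in> symmetric_nbhds_0" "\<And>x y. x \<in> V \<Longrightarrow> y \<in> V \<Longrightarrow> x + y \<in> U"
    using symmetric_nbhd_half[OF U(1)] by blast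
  define t :: "'x \<Rightarrow> 'f" where "t = (\<lambda>z\<in>topspace T. if z = p0 then 0 else 1)"
  have "t \<in> carrier ?B"
  proof -
    have "(if h x = p0 then 0 else 1) = (1::'f)" for x using h by auto
    then show ?thesis
      unfolding t_def T_def by (intro restrict_in_C_obj continuous_map_from_add_point) simp
  qed
  then obtain g where g: "g \<in> B" "\<And>z. z \<in> topspace T \<Longrightarrow> g z - t z \<in> V"
    using dense V(1) unfolding uniformly_dense_def by blast
  \<comment> \<open>If \<open>g (h x)\<close> and \<open>g p0\<close> were equal, their common value would be close to both \<open>1\<close> and \<open>0\<close>.\<close>
  have "r g x \<noteq> 0" if x: "x \<in> topspace S" for x
  proof
    assume "r g x = 0"
    then have eq: "g (h x) = g p0" using x by (simp add: r_def)
    have "g p0 \<in> V" using g(2)[of p0] by (simp add: t_def top_T)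
    moreover have "1 - g (h x) \<in> V"
    proof (rule symmetric_nbhds_0D(4)[OF V(1)])
      have "h x \<noteq> p0" using h by auto
      then show "g (h x) - 1 \<in> V" using g(2)[of "h x"] x by (simp add: t_def top_T)
    qed
    ultimately have "1 - g (h x) + g p0 \<in> U" by (intro V(2))
    then show False using U(2) eq by simp
  qed
  moreover have "r g \<in> I" using g(1) by (simp add: B_def)
  ultimately show ?thesis by (intro that)
qed

text \<open>The case of the complex numbers is separate because an ideal need not be closed under
  conjugation, as the Stone-Weierstrass theorem would demand there. The finite case is separate
  because the Stone-Weierstrass property is given for spaces with points in the type of the points
  of \<open>S\<close> only, and a finite type may have no room for an additional point.\<close>

lemma nowhere_zero_in_ideal:
  fixes S :: "'x topology" and I :: "('x \<Rightarrow> 'f::topological_field) set"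
  assumes sw: "stone_weierstrass TYPE('f) TYPE('x)"
    and S: "KH_obj TYPE('f) S"
    and I: "ideal I (C_obj S :: ('f, 'x \<Rightarrow> 'f) module)"
    and no_zero: "\<And>x. x \<in> topspace S \<Longrightarrow> \<exists>f\<in>I. f x \<noteq> 0"
  obtains f where "f \<in> I" "\<And>x. x \<in> topspace S \<Longrightarrow> f x \<noteq> 0"
proof -
  consider \<phi> :: "'f \<Rightarrow> complex" where "complex_identification \<phi>"
    | "finite (UNIV :: 'x set)"
    | "\<And>\<phi> :: 'f \<Rightarrow> complex. \<not> complex_identification \<phi>" "infinite (UNIV :: 'x set)"
    by blast
  then show ?thesis
  proof cases
    case 1
    show ?thesis
      by (rule nowhere_zero_in_ideal_complex[OF 1 _ I no_zero])
        (use S that in \<open>simp_all add: KH_obj_def\<close>)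
  next
    case 2
    have "finite (topspace S)" "t1_space S"
      using finite_subset[OF subset_UNIV 2] S by (simp_all add: KH_obj_def F_Tychonoff_def)
    then show ?thesis by (rule nowhere_zero_in_ideal_finite[OF _ _ I no_zero]) (use that in simp_all)
  next
    case 3
    show ?thesis
      by (rule nowhere_zero_in_ideal_infinite[OF sw 3 S I no_zero]) (use that in simp_all)
  qed
qed

lemma proper_ideal_fixed:
  fixes S :: "'x topology" and I :: "('x \<Rightarrow> 'f::topological_field) set"
  assumes sw: "stone_weierstrass TYPE('f) TYPE('x)"
    and S: "KH_obj TYPE('f) S"
    and I: "ideal I (C_obj S :: ('f, 'x \<Rightarrow> 'f) module)"
    and proper: "I \<noteq> carrier (C_obj S)"
  obtains x where "x \<in> topspace S" "I \<subseteq> point_ideal S x"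
proof -
  have "\<exists>x\<in>topspace S. I \<subseteq> point_ideal S x"
  proof (rule ccontr)
    assume no: "\<not> (\<exists>x\<in>topspace S. I \<subseteq> point_ideal S x)"
    interpret I: ideal I "C_obj S :: ('f, 'x \<Rightarrow> 'f) module" by fact
    have no_zero: "\<exists>f\<in>I. f x \<noteq> 0" if x: "x \<in> topspace S" for x
    proof (rule ccontr)
      assume "\<not> (\<exists>f\<in>I. f x \<noteq> 0)"
      then have "I \<subseteq> point_ideal S x" using I.Icarr x by (auto simp: point_ideal_def)
      then show False using no x by blast
    qed
    obtain f where f: "f \<in> I" "\<And>x. x \<in> topspace S \<Longrightarrow> f x \<noteq> 0"
      by (rule nowhere_zero_in_ideal[OF sw S I no_zero]) simp_all
    have "f \<in> Units (C_obj S)" by (rule nowhere_zero_Unit[OF I.Icarr[OF f(1)] f(2)])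
    then obtain g where "g \<in> carrier (C_obj S)" "g \<otimes>\<^bsub>C_obj S\<^esub> f = \<one>\<^bsub>C_obj S\<^esub>"
      unfolding Units_def by blast
    then have "\<one>\<^bsub>C_obj S\<^esub> \<in> I" using I.I_l_closed[OF f(1)] by metis
    then show False using I.one_imp_carrier proper by simp
  qed
  then show ?thesis using that by blast
qed

lemma maximal_ideals_C_obj:
  fixes S :: "'x topology"
  assumes sw: "stone_weierstrass TYPE('f::topological_field) TYPE('x)" and S: "KH_obj TYPE('f) S"
  shows "maximal_ideals (C_obj S :: ('f, 'x \<Rightarrow> 'f) module) = point_ideal S ` topspace S"
proof (intro subset_antisym subsetI)
  fix M assume M: "M \<in> maximal_ideals (C_obj S :: ('f, 'x \<Rightarrow> 'f) module)"
  interpret M: maximalideal M "C_obj S :: ('f, 'x \<Rightarrow> 'f) module"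
    using M by (simp add: maximal_ideals_def)
  obtain x where x: "x \<in> topspace S" "M \<subseteq> point_ideal S x"
    using proper_ideal_fixed[OF sw S M.ideal_axioms] M.I_notcarr by metis
  interpret N: maximalideal "point_ideal S x" "C_obj S :: ('f, 'x \<Rightarrow> 'f) module"
    using point_ideal_maximal[OF x(1)] by (simp add: maximal_ideals_def)
  have "point_ideal S x = M"
    using M.I_maximal[OF N.ideal_axioms x(2)] N.I_notcarr N.a_subset by metis
  then show "M \<in> point_ideal S ` topspace S" using x(1) by blast
qed (use point_ideal_maximal in auto)

section \<open>The algebra of continuous functions is an object of the dual category\<close>

lemma C_obj_diff_apply:
  assumes "f \<in> carrier (C_obj S)" "g \<in> carrier (C_obj S)" "x \<in> topspace S"
  shows "(f \<ominus>\<^bsub>C_obj S\<^esub> g) x = f x - (g x :: 'f::topological_field)"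
  using F_alg.character_diff[OF F_alg_C_obj character_evaluation[OF assms(3)] assms(1,2)] .

lemma spectrum_C_obj:
  fixes f :: "'x \<Rightarrow> 'f::topological_field"
  assumes f: "f \<in> carrier (C_obj S)"
  shows "spectrum (C_obj S) f = f ` topspace S"
proof -
  interpret F_alg "C_obj S :: ('f, 'x \<Rightarrow> 'f) module" by (rule F_alg_C_obj)
  have "f \<ominus>\<^bsub>C_obj S\<^esub> scalar (C_obj S) k \<in> Units (C_obj S) \<longleftrightarrow> (\<forall>x\<in>topspace S. f x \<noteq> k)" for k
  proof -
    have "(f \<ominus>\<^bsub>C_obj S\<^esub> scalar (C_obj S) k) x = f x - k" if "x \<in> topspace S" for x
      using C_obj_diff_apply[OF f scalar_closed that] that by (simp add: scalar_def)
    moreover have "f \<ominus>\<^bsub>C_obj S\<^esub> scalar (C_obj S) k \<in> carrier (C_obj S)"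
      by (intro M.minus_closed f scalar_closed)
    ultimately show ?thesis by (simp add: C_obj_Units_iff)
  qed
  then show ?thesis by (auto simp: spectrum_def)
qed

text \<open>A filter on \<open>C(S)\<close> that is Cauchy for uniform convergence converges pointwise by completeness
  of the field, hence uniformly, and a uniform limit of continuous functions is continuous.\<close>

lemma uniform_Cauchy_filter_converges:
  fixes \<F> :: "('x \<Rightarrow> 'f::topological_field) filter"
  assumes complete: "complete_field TYPE('f)" and "\<F> \<noteq> bot"
    and carrier: "\<F> \<le> principal (carrier (C_obj S))"
    and Cauchy: "\<And>U. U \<in> symmetric_nbhds_0 \<Longrightarrow>
      eventually (\<lambda>(f, g). \<forall>x\<in>topspace S. g x - f x \<in> U) (\<F> \<times>\<^sub>F \<F>)"
  obtains g where "g \<in> carrier (C_obj S)"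
    "\<And>U. U \<in> symmetric_nbhds_0 \<Longrightarrow> eventually (\<lambda>f. \<forall>x\<in>topspace S. f x - g x \<in> U) \<F>"
proof -
  have in_carrier: "eventually (\<lambda>f. f \<in> carrier (C_obj S)) \<F>"
    using carrier by (simp add: le_principal)
  have "\<exists>l. \<forall>U\<in>symmetric_nbhds_0. eventually (\<lambda>f. f x - l \<in> U) \<F>" if x: "x \<in> topspace S" for x
  proof -
    define \<G> where "\<G> = filtermap (\<lambda>f. f x) \<F>"
    have "\<G> \<times>\<^sub>F \<G> \<le> additive_uniformity"
    proof (rule filter_leI)
      fix P :: "'f \<times> 'f \<Rightarrow> bool" assume "eventually P additive_uniformity"
      then obtain U where U: "U \<in> symmetric_nbhds_0" "\<forall>a b. b - a \<in> U \<longrightarrow> P (a, b)"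
        by (auto simp: eventually_additive_uniformity)
      from Cauchy[OF U(1)] obtain Q R where Q: "eventually Q \<F>" "eventually R \<F>"
          "\<And>f g. Q f \<Longrightarrow> R g \<Longrightarrow> \<forall>x\<in>topspace S. g x - f x \<in> U"
        unfolding eventually_prod_filter by auto
      have *: "P (f x, g x)" if "Q f" "R g" for f g
        using Q(3)[OF that] x U(2) by simp
      have "eventually (\<lambda>p. P (fst p x, snd p x)) (\<F> \<times>\<^sub>F \<F>)"
        unfolding eventually_prod_filter using Q(1,2) *
        by (intro exI[of _ Q] exI[of _ R]) simp
      then show "eventually P (\<G> \<times>\<^sub>F \<G>)"
        unfolding \<G>_def prod_filtermap1 prod_filtermap2 eventually_filtermap by (simp add: case_prod_beta)
    qed
    moreover have "\<G> \<noteq> bot" using \<open>\<F> \<noteq> bot\<close> by (simp add: \<G>_def filtermap_bot_iff)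
    ultimately obtain l where l: "\<And>P. eventually P additive_uniformity \<Longrightarrow> eventually (\<lambda>y. P (l, y)) \<G>"
      using complete unfolding complete_field_def complete_wrt_def
      by (metis principal_UNIV top_greatest)
    have "eventually (\<lambda>f. f x - l \<in> U) \<F>" if U: "U \<in> symmetric_nbhds_0" for U
    proof -
      have "eventually (\<lambda>(a, b). b - a \<in> U) additive_uniformity"
        unfolding eventually_additive_uniformity using U by auto
      from l[OF this] show ?thesis by (simp add: \<G>_def eventually_filtermap)
    qed
    then show ?thesis by blast
  qed
  then obtain l where l: "\<And>x U. x \<in> topspace S \<Longrightarrow> U \<in> symmetric_nbhds_0 \<Longrightarrow>
      eventually (\<lambda>f. f x - l x \<in> U) \<F>"
    by metis
  have uniform: "eventually (\<lambda>f. \<forall>x\<in>topspace S. f x - l x \<in> U) \<F>" if U: "U \<in> symmetric_nbhds_0" for U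
  proof -
    obtain V where V: "V \<in> symmetric_nbhds_0" "\<And>a b. a \<in> V \<Longrightarrow> b \<in> V \<Longrightarrow> a + b \<in> U"
      using symmetric_nbhd_half[OF U] by blast
    from Cauchy[OF V(1)] obtain Q R where Q: "eventually Q \<F>" "eventually R \<F>"
        "\<And>f g. Q f \<Longrightarrow> R g \<Longrightarrow> \<forall>x\<in>topspace S. g x - f x \<in> V"
      unfolding eventually_prod_filter by auto
    show ?thesis
    proof (rule eventually_mono[OF Q(2)], intro ballI)
      fix g x assume g: "R g" and x: "x \<in> topspace S"
      obtain f where f: "Q f" "f x - l x \<in> V"
        using eventually_happens'[OF \<open>\<F> \<noteq> bot\<close> eventually_conj[OF Q(1) l[OF x V(1)]]] by blast
      have "(g x - f x) + (f x - l x) \<in> U"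
        using Q(3)[OF f(1) g] x f(2) by (intro V(2)) auto
      then show "g x - l x \<in> U" by simp
    qed
  qed
  have "continuous_map S euclidean l"
  proof (rule continuous_map_nbhd)
    fix x and U :: "'f set" assume x: "x \<in> topspace S" and U: "U \<in> symmetric_nbhds_0"
    obtain V where V: "V \<in> symmetric_nbhds_0" "\<And>a b. a \<in> V \<Longrightarrow> b \<in> V \<Longrightarrow> a + b \<in> U"
      using symmetric_nbhd_half[OF U] by blast
    obtain W where W: "W \<in> symmetric_nbhds_0" "\<And>a b. a \<in> W \<Longrightarrow> b \<in> W \<Longrightarrow> a + b \<in> V"
      using symmetric_nbhd_half[OF V(1)] by blast
    have WV: "a \<in> V" if "a \<in> W" for a
      using W(2)[OF that symmetric_nbhds_0D(2)[OF W(1)]] by simp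
    obtain f where f: "f \<in> carrier (C_obj S)" "\<forall>x\<in>topspace S. f x - l x \<in> W"
      using eventually_happens'[OF \<open>\<F> \<noteq> bot\<close> eventually_conj[OF in_carrier uniform[OF W(1)]]] by blast
    obtain N where N: "openin S N" "x \<in> N" "\<And>y. y \<in> N \<Longrightarrow> f y - f x \<in> W"
      using continuous_map_nbhdD[OF C_obj_continuous[OF f(1)] x W(1)] by blast
    have "l y - l x \<in> U" if y: "y \<in> N" for y
    proof -
      have "y \<in> topspace S" using y openin_subset[OF N(1)] by blast
      then have "l y - f y \<in> W" using f(2) symmetric_nbhds_0D(4)[OF W(1)] by blast
      then have "(l y - f y) + (f y - f x) \<in> V" using N(3)[OF y] by (rule W(2))
      moreover have "f x - l x \<in> V" using f(2) x WV by blast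
      ultimately have "((l y - f y) + (f y - f x)) + (f x - l x) \<in> U" by (rule V(2))
      then show ?thesis by simp
    qed
    then show "\<exists>N. openin S N \<and> x \<in> N \<and> (\<forall>y\<in>N. l y - l x \<in> U)" using N(1,2) by blast
  qed
  then have "(\<lambda>x\<in>topspace S. l x) \<in> carrier (C_obj S)" by (rule restrict_in_C_obj)
  then show ?thesis by (rule that) (use uniform in simp)
qed

context
  fixes S :: "'x topology"
  assumes sw: "stone_weierstrass TYPE('f::topological_field) TYPE('x)" and S: "KH_obj TYPE('f) S"
begin

lemma ball_maximal_ideals_C_obj:
  "(\<forall>M\<in>maximal_ideals (C_obj S :: ('f, 'x \<Rightarrow> 'f) module). Q M) \<longleftrightarrow> (\<forall>x\<in>topspace S. Q (point_ideal S x))"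
  by (simp add: maximal_ideals_C_obj[OF sw S])

lemma eventually_canonical_uniformity_C_obj:
  "eventually P (canonical_uniformity (C_obj S :: ('f, 'x \<Rightarrow> 'f) module)) \<longleftrightarrow>
     (\<exists>U\<in>symmetric_nbhds_0. \<forall>f\<in>carrier (C_obj S). \<forall>g\<in>carrier (C_obj S).
        (\<forall>x\<in>topspace S. g x - f x \<in> U) \<longrightarrow> P (f, g))"
proof -
  let ?A = "C_obj S :: ('f, 'x \<Rightarrow> 'f) module"
  interpret F_alg ?A by (rule F_alg_C_obj)
  have "(\<forall>M\<in>maximal_ideals ?A. residue_value ?A M (g \<ominus>\<^bsub>?A\<^esub> f) \<in> U) \<longleftrightarrow> (\<forall>x\<in>topspace S. g x - f x \<in> U)"
    if "f \<in> carrier ?A" "g \<in> carrier ?A" for f g U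
    unfolding ball_maximal_ideals_C_obj using that
    by (simp add: residue_value_point_ideal C_obj_diff_apply M.minus_closed)
  then show ?thesis unfolding eventually_canonical_uniformity by (simp cong: ball_cong)
qed

lemma gelfand_C_obj: "gelfand (C_obj S :: ('f, 'x \<Rightarrow> 'f) module)"
  unfolding gelfand_def ball_maximal_ideals_C_obj
  by (simp add: point_ideal_eq_char_kernel F_alg.canonical_map_char_kernel F_alg_C_obj character_evaluation)

lemma semisimple_C_obj: "semisimple (C_obj S :: ('f, 'x \<Rightarrow> 'f) module)"
proof -
  let ?A = "C_obj S :: ('f, 'x \<Rightarrow> 'f) module"
  have eq: "f = \<zero>\<^bsub>?A\<^esub>" if f: "f \<in> carrier ?A" "\<forall>x\<in>topspace S. f \<in> point_ideal S x" for f
  proof (rule C_obj_eqI[OF f(1)])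
    show "\<zero>\<^bsub>?A\<^esub> \<in> carrier ?A" using C_obj_const[of "0::'f" S] by simp
    show "f x = \<zero>\<^bsub>?A\<^esub> x" if "x \<in> topspace S" for x
      using f(2) that by (simp add: point_ideal_def)
  qed
  have zero: "\<zero>\<^bsub>?A\<^esub> \<in> carrier ?A" "\<forall>x\<in>topspace S. \<zero>\<^bsub>?A\<^esub> \<in> point_ideal S x"
    using C_obj_const[of "0::'f" S] by (simp_all add: point_ideal_def)
  show ?thesis
    unfolding semisimple_def ball_maximal_ideals_C_obj using zero eq by blast
qed

text \<open>Two points of a compact \<open>F\<close>-Tychonoff space have disjoint neighbourhoods, and functions that
  are supported in these neighbourhoods have product zero. Hence a prime ideal cannot vanish at
  both points.\<close>

lemma prime_ideal_C_obj_unique_maximal: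
  assumes P: "primeideal P (C_obj S :: ('f, 'x \<Rightarrow> 'f) module)"
  shows "\<exists>!M. M \<in> maximal_ideals (C_obj S :: ('f, 'x \<Rightarrow> 'f) module) \<and> P \<subseteq> M"
proof -
  let ?A = "C_obj S :: ('f, 'x \<Rightarrow> 'f) module"
  interpret P: primeideal P ?A by fact
  have Tych: "F_Tychonoff TYPE('f) S" using S by (simp add: KH_obj_def)
  note Haus = Hausdorff_F_Tychonoff[OF Tych]
  obtain x where x: "x \<in> topspace S" "P \<subseteq> point_ideal S x"
    using proper_ideal_fixed[OF sw S P.ideal_axioms] P.I_notcarr by metis
  have "y = x" if y: "y \<in> topspace S" "P \<subseteq> point_ideal S y" for y
  proof (rule ccontr)
    assume "y \<noteq> x"
    then obtain U V where UV: "openin S U" "openin S V" "x \<in> U" "y \<in> V" "disjnt U V"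
      using Haus x y unfolding Hausdorff_space_def by metis
    have "closedin S (topspace S - U)" "closedin S (topspace S - V)"
      using UV by auto
    then obtain a b :: "'x \<Rightarrow> 'f" where a: "a \<in> carrier ?A" "a x = 1" "\<And>z. z \<in> topspace S - U \<Longrightarrow> a z = 0"
      and b: "b \<in> carrier ?A" "b y = 1" "\<And>z. z \<in> topspace S - V \<Longrightarrow> b z = 0"
      using F_Tychonoff_separates[OF Tych _ x(1), of "topspace S - U"]
        F_Tychonoff_separates[OF Tych _ y(1), of "topspace S - V"] UV by (metis DiffE)
    have "a z * b z = 0" if "z \<in> topspace S" for z
      using a(3)[of z] b(3)[of z] that UV(5) by (auto simp: disjnt_iff)
    then have "a \<otimes>\<^bsub>?A\<^esub> b = \<zero>\<^bsub>?A\<^esub>" by (auto simp: fun_eq_iff)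
    moreover have "\<zero>\<^bsub>?A\<^esub> \<in> P"
      by (rule additive_subgroup.zero_closed[OF ideal.axioms(1)[OF P.ideal_axioms]])
    ultimately have "a \<in> P \<or> b \<in> P" using P.I_prime[OF a(1) b(1)] by simp
    then show False using a(2) b(2) x y by (auto simp: point_ideal_def)
  qed
  then show ?thesis
    unfolding maximal_ideals_C_obj[OF sw S] using x by blast
qed

lemma complete_C_obj:
  assumes "complete_field TYPE('f)"
  shows "complete_wrt (canonical_uniformity (C_obj S :: ('f, 'x \<Rightarrow> 'f) module)) (carrier (C_obj S))"
  unfolding complete_wrt_def
proof (intro allI impI)
  let ?A = "C_obj S :: ('f, 'x \<Rightarrow> 'f) module"
  fix \<F> :: "('x \<Rightarrow> 'f) filter"
  assume \<F>: "\<F> \<le> principal (carrier ?A)" "\<F> \<noteq> bot" "\<F> \<times>\<^sub>F \<F> \<le> canonical_uniformity ?A"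
  have "eventually (\<lambda>(f, g). \<forall>x\<in>topspace S. g x - f x \<in> U) (\<F> \<times>\<^sub>F \<F>)"
    if "U \<in> symmetric_nbhds_0" for U
    by (rule filter_leD[OF \<F>(3)])
      (use that in \<open>auto simp: eventually_canonical_uniformity_C_obj\<close>)
  then obtain g where g: "g \<in> carrier ?A"
      "\<And>U. U \<in> symmetric_nbhds_0 \<Longrightarrow> eventually (\<lambda>f. \<forall>x\<in>topspace S. f x - g x \<in> U) \<F>"
    using uniform_Cauchy_filter_converges[OF assms \<F>(2,1)] by blast
  have "eventually (\<lambda>f. P (g, f)) \<F>" if P: "eventually P (canonical_uniformity ?A)" for P
  proof -
    obtain U where U: "U \<in> symmetric_nbhds_0"
      "\<And>f h. f \<in> carrier ?A \<Longrightarrow> h \<in> carrier ?A \<Longrightarrow> \<forall>x\<in>topspace S. h x - f x \<in> U \<Longrightarrow> P (f, h)"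
      using P unfolding eventually_canonical_uniformity_C_obj by blast
    have "eventually (\<lambda>f. f \<in> carrier ?A) \<F>" using \<F>(1) by (simp add: le_principal)
    with g(2)[OF U(1)] show ?thesis
      by eventually_elim (rule U(2)[OF g(1)])
  qed
  then show "\<exists>g\<in>carrier ?A. \<forall>P. eventually P (canonical_uniformity ?A) \<longrightarrow> eventually (\<lambda>f. P (g, f)) \<F>"
    using g(1) by blast
qed

lemma conjugation_closed_C_obj: "conjugation_closed (C_obj S :: ('f, 'x \<Rightarrow> 'f) module)"
  unfolding conjugation_closed_def ball_maximal_ideals_C_obj
proof (intro allI impI ballI)
  fix \<phi> :: "'f \<Rightarrow> complex" and f :: "'x \<Rightarrow> 'f"
  assume \<phi>: "complex_identification \<phi>" and f: "f \<in> carrier (C_obj S)"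
  let ?g = "\<lambda>x\<in>topspace S. inv_into UNIV \<phi> (cnj (\<phi> (f x)))"
  have g: "?g \<in> carrier (C_obj S)" by (rule conjugate_in_C_obj[OF \<phi> f])
  show "\<exists>g\<in>carrier (C_obj S). \<forall>x\<in>topspace S.
      \<phi> (residue_value (C_obj S) (point_ideal S x) g) = cnj (\<phi> (residue_value (C_obj S) (point_ideal S x) f))"
    using g by (intro bexI[of _ ?g])
      (simp_all add: residue_value_point_ideal f complex_identification_facts(4)[OF \<phi>])
qed

lemma GA_obj_C_obj:
  assumes "complete_field TYPE('f)"
  shows "GA_obj (C_obj S :: ('f, 'x \<Rightarrow> 'f) module)"
proof -
  let ?A = "C_obj S :: ('f, 'x \<Rightarrow> 'f) module"
  have "compact (spectrum ?A f)" if "f \<in> carrier ?A" for f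
    using image_compactin[OF _ C_obj_continuous[OF that], of "topspace S"] S
    by (simp add: KH_obj_def compact_space_def spectrum_C_obj[OF that])
  moreover have "F_algebra ?A" by (rule F_alg.F_algebra[OF F_alg_C_obj])
  ultimately show ?thesis
    unfolding GA_obj_def
    using gelfand_C_obj semisimple_C_obj conjugation_closed_C_obj
      prime_ideal_C_obj_unique_maximal complete_C_obj[OF assms]
    by blast
qed

end

section \<open>The Gelfand transform\<close>

locale gelfand_algebra =
  fixes A :: "('f::topological_field, 'a) module" (structure)
  assumes GA_obj: "GA_obj A"
begin

sublocale F_alg A
  using GA_obj by unfold_locales (simp add: GA_obj_def)

lemma gelfand: "gelfand A"
  using GA_obj by (simp add: GA_obj_def)

lemma
  assumes M: "M \<in> maximal_ideals A"
  shows residue_character: "character A (residue_value A M)"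
    and residue_value_eq_0_iff: "a \<in> carrier A \<Longrightarrow> residue_value A M a = 0 \<longleftrightarrow> a \<in> M"
    and residue_value_diff:
      "a \<in> carrier A \<Longrightarrow> b \<in> carrier A \<Longrightarrow> residue_value A M (a \<ominus> b) = residue_value A M a - residue_value A M b"
proof -
  show \<psi>: "character A (residue_value A M)" by (rule character_residue_value[OF gelfand M])
  show "a \<in> carrier A \<Longrightarrow> residue_value A M a = 0 \<longleftrightarrow> a \<in> M"
    using char_kernel_residue_value[OF gelfand M] by (auto simp: char_kernel_def)
  show "a \<in> carrier A \<Longrightarrow> b \<in> carrier A \<Longrightarrow> residue_value A M (a \<ominus> b) = residue_value A M a - residue_value A M b"
    by (rule character_diff[OF \<psi>])
qed

lemma gelfand_transform_closed:
  assumes "a \<in> carrier A"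
  shows "gelfand_transform A a \<in> carrier (C_obj (Max_obj A))"
proof -
  have "continuous_map (Max_obj A) euclidean (\<lambda>M. residue_value A M a)"
    using GA_obj assms by (intro continuous_map_residue_value) (simp_all add: GA_obj_def)
  from restrict_in_C_obj[OF this] show ?thesis
    using assms by (simp add: gelfand_transform_def topspace_Max_obj)
qed

lemma gelfand_transform_apply:
  "a \<in> carrier A \<Longrightarrow> M \<in> maximal_ideals A \<Longrightarrow> gelfand_transform A a M = residue_value A M a"
  by (simp add: gelfand_transform_def)

lemma gelfand_transform_hom: "gelfand_transform A \<in> GA_hom A (C_obj (Max_obj A))"
proof -
  have "gelfand_transform A \<in> ring_hom A (C_obj (Max_obj A))"
    by (rule ring_hom_memI)
      (auto simp: gelfand_transform_closed, auto simp: gelfand_transform_def topspace_Max_obj fun_eq_iff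
        character_add character_mult character_one residue_character)
  moreover have "gelfand_transform A (k \<odot>\<^bsub>A\<^esub> a) = k \<odot>\<^bsub>C_obj (Max_obj A)\<^esub> gelfand_transform A a"
    if "a \<in> carrier A" for k a
    using that by (auto simp: gelfand_transform_def topspace_Max_obj fun_eq_iff character_smult residue_character)
  ultimately show ?thesis by (simp add: GA_hom_def gelfand_transform_def)
qed

text \<open>An element whose transform vanishes lies in all maximal ideals.\<close>

lemma inj_on_gelfand_transform: "inj_on (gelfand_transform A) (carrier A)"
proof (rule inj_onI)
  fix a b assume ab: "a \<in> carrier A" "b \<in> carrier A" and eq: "gelfand_transform A a = gelfand_transform A b"
  have "a \<ominus> b \<in> M" if M: "M \<in> maximal_ideals A" for M
  proof -
    have "residue_value A M a = residue_value A M b"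
      using fun_cong[OF eq, of M] ab M by (simp add: gelfand_transform_apply)
    then have "residue_value A M (a \<ominus> b) = 0" by (simp add: residue_value_diff[OF M ab])
    then show ?thesis using residue_value_eq_0_iff[OF M M.minus_closed[OF ab]] by simp
  qed
  then have "a \<ominus> b \<in> {a \<in> carrier A. \<forall>M\<in>maximal_ideals A. a \<in> M}"
    using M.minus_closed[OF ab] by blast
  also have "\<dots> = {\<zero>}" using GA_obj by (simp add: GA_obj_def semisimple_def)
  finally have "a \<ominus> b = \<zero>" by simp
  then show "a = b" using ring.r_right_minus_eq[OF cring.axioms(1)[OF M_cring] ab] by simp
qed

text \<open>Distinct maximal ideals are separated by an element of one that is missing from the other, and
  \<open>conjugation_closed\<close> supplies the additional hypothesis of the Stone-Weierstrass theorem over the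
  complex numbers.\<close>

lemma gelfand_transform_dense:
  assumes sw: "stone_weierstrass TYPE('f) TYPE('a set)"
  shows "uniformly_dense (Max_obj A) (gelfand_transform A ` carrier A)"
proof -
  let ?C = "C_obj (Max_obj A) :: ('f, 'a set \<Rightarrow> 'f) module"
  let ?B = "gelfand_transform A ` carrier A"
  have hom: "gelfand_transform A \<in> ring_hom A ?C"
    and smult: "\<And>k a. a \<in> carrier A \<Longrightarrow> gelfand_transform A (k \<odot>\<^bsub>A\<^esub> a) = k \<odot>\<^bsub>?C\<^esub> gelfand_transform A a"
    using gelfand_transform_hom by (simp_all add: GA_hom_def)
  have "KH_obj TYPE('f) (Max_obj A)" by (rule KH_obj_Max_obj[OF GA_obj])
  then have "compact_space (Max_obj A)" "Hausdorff_space (Max_obj A)"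
    using Hausdorff_F_Tychonoff by (auto simp: KH_obj_def)
  moreover have "F_subalgebra ?B ?C"
  proof (rule F_alg.F_subalgebraI[OF F_alg_C_obj])
    show "?B \<subseteq> carrier ?C" using gelfand_transform_closed by blast
    show "\<one>\<^bsub>?C\<^esub> \<in> ?B" using ring_hom_memE(4)[OF hom] one_closed by (metis imageI)
    fix f g assume "f \<in> ?B" "g \<in> ?B"
    then obtain a b where ab: "a \<in> carrier A" "b \<in> carrier A" and
      fg: "f = gelfand_transform A a" "g = gelfand_transform A b" by blast
    show "f \<oplus>\<^bsub>?C\<^esub> g \<in> ?B"
      unfolding fg ring_hom_memE(3)[OF hom ab, symmetric] using ab by blast
    show "f \<otimes>\<^bsub>?C\<^esub> g \<in> ?B"
      unfolding fg ring_hom_memE(2)[OF hom ab, symmetric] using ab by blast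
  next
    fix k f assume "f \<in> ?B"
    then obtain a where a: "a \<in> carrier A" "f = gelfand_transform A a" by blast
    show "k \<odot>\<^bsub>?C\<^esub> f \<in> ?B"
      unfolding a(2) smult[OF a(1), symmetric] using a(1) by (intro imageI smult_closed) simp_all
  qed
  moreover have "separates_points (Max_obj A) ?B"
    unfolding separates_points_def topspace_Max_obj
  proof (intro ballI impI)
    fix M N assume MN: "M \<in> maximal_ideals A" "N \<in> maximal_ideals A" "M \<noteq> N"
    have sub: "N \<subseteq> carrier A" "M \<subseteq> carrier A"
      using MN maximal_ideal_ideal by (auto dest: ideal.Icarr)
    then obtain a where a: "a \<in> carrier A" "a \<in> M \<longleftrightarrow> a \<notin> N" using MN(3) by blast
    then have "residue_value A M a \<noteq> residue_value A N a"
      using residue_value_eq_0_iff[OF MN(1) a(1)] residue_value_eq_0_iff[OF MN(2) a(1)] by metis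
    then show "\<exists>g\<in>?B. g M \<noteq> g N"
      using a(1) MN(1,2)
      by (intro bexI[of _ "gelfand_transform A a"]) (simp_all add: gelfand_transform_apply)
  qed
  moreover have "(\<lambda>M\<in>topspace (Max_obj A). inv_into UNIV \<phi> (cnj (\<phi> (f M)))) \<in> ?B"
    if \<phi>: "complex_identification \<phi>" and f: "f \<in> ?B" for \<phi> f
  proof -
    obtain a where a: "a \<in> carrier A" "f = gelfand_transform A a" using f by blast
    have "conjugation_closed A" using GA_obj by (simp add: GA_obj_def)
    then obtain b where b: "b \<in> carrier A"
      "\<And>M. M \<in> maximal_ideals A \<Longrightarrow> \<phi> (residue_value A M b) = cnj (\<phi> (residue_value A M a))"
      using \<phi> a(1) unfolding conjugation_closed_def by meson
    have "inv_into UNIV \<phi> (cnj (\<phi> (f M))) = residue_value A M b" if M: "M \<in> maximal_ideals A" for M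
    proof -
      have "\<phi> (inv_into UNIV \<phi> (cnj (\<phi> (f M)))) = \<phi> (residue_value A M b)"
        using b(2)[OF M] a M by (simp add: complex_identification_facts(4)[OF \<phi>] gelfand_transform_apply)
      then show ?thesis by (simp only: complex_identification_facts(5)[OF \<phi>])
    qed
    then have "(\<lambda>M\<in>topspace (Max_obj A). inv_into UNIV \<phi> (cnj (\<phi> (f M)))) = gelfand_transform A b"
      using b(1) by (auto simp: gelfand_transform_def topspace_Max_obj)
    then show ?thesis using b(1) by blast
  qed
  ultimately show ?thesis using sw unfolding stone_weierstrass_def by blast
qed

text \<open>The elements whose transforms approximate a given continuous function better and better form a
  Cauchy filter on \<open>A\<close>; the transform of its limit is that function.\<close>

lemma gelfand_transform_surj:
  assumes sw: "stone_weierstrass TYPE('f) TYPE('a set)"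
    and f: "f \<in> carrier (C_obj (Max_obj A))"
  obtains a where "a \<in> carrier A" "gelfand_transform A a = f"
proof -
  define E where "E U = {a \<in> carrier A. \<forall>M\<in>maximal_ideals A. residue_value A M a - f M \<in> U}" for U
  have E_ne: "\<exists>a. a \<in> E U" if "U \<in> symmetric_nbhds_0" for U
  proof -
    obtain g where g: "g \<in> gelfand_transform A ` carrier A" "\<forall>M\<in>topspace (Max_obj A). g M - f M \<in> U"
      using gelfand_transform_dense[OF sw] f \<open>U \<in> symmetric_nbhds_0\<close> unfolding uniformly_dense_def by blast
    then obtain a where "a \<in> carrier A" "g = gelfand_transform A a" by blast
    then have "a \<in> E U" using g(2) by (simp add: E_def topspace_Max_obj gelfand_transform_apply)
    then show ?thesis by blast
  qed
  define \<F> where "\<F> = (INF U\<in>symmetric_nbhds_0. principal (E U))"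
  have ev: "eventually P \<F> \<longleftrightarrow> (\<exists>U\<in>symmetric_nbhds_0. \<forall>a\<in>E U. P a)" for P
    unfolding \<F>_def by (rule eventually_INF_symmetric_nbhds) (auto simp: E_def)
  have ne: "\<F> \<noteq> bot"
    using E_ne by (auto simp: trivial_limit_def ev)
  moreover have "\<F> \<le> principal (carrier A)"
    using UNIV_symmetric_nbhd by (auto simp: le_principal ev E_def)
  moreover have "\<F> \<times>\<^sub>F \<F> \<le> canonical_uniformity A"
  proof (rule filter_leI)
    fix P assume "eventually P (canonical_uniformity A)"
    then obtain U where U: "U \<in> symmetric_nbhds_0"
      "\<And>a b. a \<in> carrier A \<Longrightarrow> b \<in> carrier A \<Longrightarrow>
        \<forall>M\<in>maximal_ideals A. residue_value A M (b \<ominus> a) \<in> U \<Longrightarrow> P (a, b)"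
      unfolding eventually_canonical_uniformity by blast
    obtain V where V: "V \<in> symmetric_nbhds_0" "\<And>s t. s \<in> V \<Longrightarrow> t \<in> V \<Longrightarrow> s + t \<in> U"
      using symmetric_nbhd_half[OF U(1)] by blast
    have "P (a, b)" if ab: "a \<in> E V" "b \<in> E V" for a b
    proof (rule U(2))
      show carr: "a \<in> carrier A" "b \<in> carrier A" using ab by (simp_all add: E_def)
      show "\<forall>M\<in>maximal_ideals A. residue_value A M (b \<ominus> a) \<in> U"
      proof
        fix M assume M: "M \<in> maximal_ideals A"
        have "f M - residue_value A M a \<in> V"
          using ab(1) M by (intro symmetric_nbhds_0D(4)[OF V(1), of "residue_value A M a" "f M"]) (simp add: E_def)
        moreover have "residue_value A M b - f M \<in> V" using ab(2) M by (simp add: E_def)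
        ultimately have "(residue_value A M b - f M) + (f M - residue_value A M a) \<in> U" by (intro V(2))
        then show "residue_value A M (b \<ominus> a) \<in> U"
          by (simp add: residue_value_diff[OF M carr(2,1)])
      qed
    qed
    moreover have "eventually (\<lambda>a. a \<in> E V) \<F>" using V(1) by (auto simp: ev)
    ultimately show "eventually P (\<F> \<times>\<^sub>F \<F>)"
      unfolding eventually_prod_filter by blast
  qed
  moreover have "complete_wrt (canonical_uniformity A) (carrier A)"
    using GA_obj by (simp add: GA_obj_def)
  ultimately obtain a where a: "a \<in> carrier A"
    "\<And>P. eventually P (canonical_uniformity A) \<Longrightarrow> eventually (\<lambda>b. P (a, b)) \<F>"
    unfolding complete_wrt_def by blast
  have "residue_value A M a = f M" if M: "M \<in> maximal_ideals A" for M
  proof (rule eq_if_difference_small)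
    fix U :: "'f set" assume U: "U \<in> symmetric_nbhds_0"
    obtain V where V: "V \<in> symmetric_nbhds_0" "\<And>s t. s \<in> V \<Longrightarrow> t \<in> V \<Longrightarrow> s + t \<in> U"
      using symmetric_nbhd_half[OF U] by blast
    have "eventually (\<lambda>(a, b). \<forall>M\<in>maximal_ideals A. residue_value A M (b \<ominus> a) \<in> V) (canonical_uniformity A)"
      unfolding eventually_canonical_uniformity using V(1) by auto
    from a(2)[OF this]
    have "eventually (\<lambda>b. \<forall>M\<in>maximal_ideals A. residue_value A M (b \<ominus> a) \<in> V) \<F>" by simp
    moreover have "eventually (\<lambda>b. b \<in> E V) \<F>" using V(1) by (auto simp: ev)
    ultimately obtain b where b: "b \<in> E V" "\<forall>M\<in>maximal_ideals A. residue_value A M (b \<ominus> a) \<in> V"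
      using eventually_happens'[OF ne eventually_conj] by blast
    have "f M - residue_value A M b \<in> V"
      using b(1) M by (intro symmetric_nbhds_0D(4)[OF V(1), of "residue_value A M b" "f M"]) (simp add: E_def)
    moreover have "residue_value A M b - residue_value A M a \<in> V"
      using bspec[OF b(2) M] b(1) a(1) residue_value_diff[OF M, of b a] by (simp add: E_def)
    ultimately have "(f M - residue_value A M b) + (residue_value A M b - residue_value A M a) \<in> U"
      by (rule V(2))
    then show "f M - residue_value A M a \<in> U" by simp
  qed
  then have "gelfand_transform A a = f"
    using a(1) by (intro C_obj_eqI[OF gelfand_transform_closed f])
      (simp_all add: topspace_Max_obj gelfand_transform_apply)
  with a(1) show ?thesis by (rule that)
qed

lemma gelfand_transform_iso:
  assumes "stone_weierstrass TYPE('f) TYPE('a set)"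
  shows "gelfand_transform A \<in> GA_iso A (C_obj (Max_obj A))"
proof -
  have "gelfand_transform A ` carrier A = carrier (C_obj (Max_obj A))"
    using gelfand_transform_closed gelfand_transform_surj[OF assms] by blast
  then have "bij_betw (gelfand_transform A) (carrier A) (carrier (C_obj (Max_obj A)))"
    using inj_on_gelfand_transform by (simp add: bij_betw_def)
  then show ?thesis
    using gelfand_transform_hom by (simp add: GA_iso_def ring_iso_def GA_hom_def)
qed

end

section \<open>Functoriality and naturality\<close>

lemma C_map_apply:
  "g \<in> carrier (C_obj T) \<Longrightarrow> C_map S T f g = (\<lambda>x\<in>topspace S. g (f x))"
  by (auto simp: C_map_def compose_def)

lemma KH_hom_maps: "f \<in> KH_hom S T \<Longrightarrow> x \<in> topspace S \<Longrightarrow> f x \<in> topspace T"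
  by (auto simp: KH_hom_def continuous_map_def)

lemma C_map_closed:
  assumes "f \<in> KH_hom S T" "g \<in> carrier (C_obj T :: ('f::topological_field, 'y \<Rightarrow> 'f) module)"
  shows "C_map S T f g \<in> carrier (C_obj S)"
proof -
  have "continuous_map S euclidean (g \<circ> f)"
    using assms C_obj_continuous by (auto simp: KH_hom_def intro: continuous_map_compose)
  then show ?thesis
    using assms(2) by (simp add: C_map_apply restrict_in_C_obj o_def)
qed

lemma C_map_hom:
  assumes f: "f \<in> KH_hom S T"
  shows "C_map S T f \<in> GA_hom (C_obj T :: ('f::topological_field, 'y \<Rightarrow> 'f) module) (C_obj S)"
proof -
  let ?A = "C_obj T :: ('f, 'y \<Rightarrow> 'f) module"
  interpret F_alg ?A by (rule F_alg_C_obj)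
  have "C_map S T f \<in> ring_hom ?A (C_obj S)"
  proof (rule ring_hom_memI)
    fix g h assume gh: "g \<in> carrier ?A" "h \<in> carrier ?A"
    show "C_map S T f (g \<otimes>\<^bsub>?A\<^esub> h) = C_map S T f g \<otimes>\<^bsub>C_obj S\<^esub> C_map S T f h"
      "C_map S T f (g \<oplus>\<^bsub>?A\<^esub> h) = C_map S T f g \<oplus>\<^bsub>C_obj S\<^esub> C_map S T f h"
      by (simp_all add: fun_eq_iff C_map_apply C_obj_closed gh KH_hom_maps[OF f])
  next
    show "C_map S T f \<one>\<^bsub>?A\<^esub> = \<one>\<^bsub>C_obj S\<^esub>"
      by (simp add: fun_eq_iff C_map_apply C_obj_const KH_hom_maps[OF f])
  qed (rule C_map_closed[OF f])
  moreover have "C_map S T f (k \<odot>\<^bsub>?A\<^esub> g) = k \<odot>\<^bsub>C_obj S\<^esub> C_map S T f g" if "g \<in> carrier ?A" for k g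
    using that by (simp add: fun_eq_iff C_map_apply C_obj_closed KH_hom_maps[OF f])
  ultimately show ?thesis by (simp add: GA_hom_def C_map_def)
qed

lemma C_map_id: "C_map S S (KH_id S) = GA_id (C_obj S :: ('f::topological_field, 'x \<Rightarrow> 'f) module)"
proof
  fix g :: "'x \<Rightarrow> 'f"
  show "C_map S S (KH_id S) g = GA_id (C_obj S :: ('f, 'x \<Rightarrow> 'f) module) g"
  proof (cases "g \<in> carrier (C_obj S)")
    case True
    have "(\<lambda>x\<in>topspace S. g (KH_id S x)) = g"
      using C_obj_restrict[OF True] by (simp add: KH_id_def cong: restrict_cong)
    then show ?thesis by (simp add: C_map_apply True GA_id_def)
  qed (simp add: C_map_def GA_id_def)
qed

lemma C_map_comp:
  fixes S :: "'x topology" and T :: "'y topology" and W :: "'z topology"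
  assumes f: "f \<in> KH_hom S T" and g: "g \<in> KH_hom T W"
  shows "C_map S W (KH_comp S g f) =
    GA_comp (C_obj W :: ('f::topological_field, 'z \<Rightarrow> 'f) module) (C_map S T f) (C_map T W g)"
proof
  fix h :: "'z \<Rightarrow> 'f"
  show "C_map S W (KH_comp S g f) h =
    GA_comp (C_obj W :: ('f, 'z \<Rightarrow> 'f) module) (C_map S T f) (C_map T W g) h"
  proof (cases "h \<in> carrier (C_obj W)")
    case True
    have "C_map S W (KH_comp S g f) h = (\<lambda>x\<in>topspace S. h (g (f x)))"
      by (auto simp: C_map_apply[OF True] KH_comp_def compose_def)
    also have "\<dots> = C_map S T f (C_map T W g h)"
      unfolding C_map_apply[OF C_map_closed[OF g True]] using KH_hom_maps[OF f]
      by (auto simp: C_map_apply[OF True])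
    finally show ?thesis using True by (simp add: GA_comp_def compose_def)
  qed (simp add: C_map_def GA_comp_def compose_def)
qed

context
  fixes A :: "('f::topological_field, 'a) module" and B :: "('f, 'b) module" and h
  assumes A: "GA_obj A" and B: "GA_obj B" and h: "h \<in> GA_hom A B"
begin

interpretation A: gelfand_algebra A by (rule gelfand_algebra.intro[OF A])
interpretation B: gelfand_algebra B by (rule gelfand_algebra.intro[OF B])

lemma GA_hom_ring_hom: "h \<in> ring_hom A B" and GA_hom_closed: "a \<in> carrier A \<Longrightarrow> h a \<in> carrier B"
  using h ring_hom_memE(1)[of h A B] by (auto simp: GA_hom_def)

text \<open>The inverse image of a maximal ideal is the kernel of the composite of its character with
  the homomorphism.\<close>

lemma
  assumes N: "N \<in> maximal_ideals B"
  shows Max_map_maximal: "Max_map A B h N \<in> maximal_ideals A"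
    and residue_value_Max_map:
      "a \<in> carrier A \<Longrightarrow> residue_value A (Max_map A B h N) a = residue_value B N (h a)"
proof -
  have \<psi>: "character A (\<lambda>a. residue_value B N (h a))"
    unfolding character_def
    using h GA_hom_closed ring_hom_memE(2-4)[OF GA_hom_ring_hom]
      B.character_one[OF B.residue_character[OF N]] B.character_add[OF B.residue_character[OF N]]
      B.character_mult[OF B.residue_character[OF N]] B.character_smult[OF B.residue_character[OF N]]
    by (simp add: GA_hom_def)
  have eq: "Max_map A B h N = char_kernel A (\<lambda>a. residue_value B N (h a))"
    using N GA_hom_closed B.residue_value_eq_0_iff[OF N] by (auto simp: Max_map_def char_kernel_def)
  show "Max_map A B h N \<in> maximal_ideals A"
    unfolding eq by (rule A.char_kernel_maximal[OF \<psi>])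
  show "a \<in> carrier A \<Longrightarrow> residue_value A (Max_map A B h N) a = residue_value B N (h a)"
    unfolding eq by (rule A.residue_value_char_kernel[OF \<psi>])
qed

lemma Max_map_hom: "Max_map A B h \<in> KH_hom (Max_obj B) (Max_obj A)"
proof -
  have "continuous_map (Max_obj B) (Max_obj A) (Max_map A B h)"
    unfolding Max_obj_def[of A]
  proof (rule continuous_on_generated_topo)
    show "Max_map A B h ` topspace (Max_obj B) \<subseteq> \<Union>{{M \<in> maximal_ideals A. a \<notin> M} | a. a \<in> carrier A}"
      using Max_map_maximal A.topspace_Max_obj
      unfolding Max_obj_def[of A] topology_generated_by_topspace B.topspace_Max_obj by auto
    fix U assume "U \<in> {{M \<in> maximal_ideals A. a \<notin> M} | a. a \<in> carrier A}"
    then obtain a where a: "a \<in> carrier A" and U: "U = {M \<in> maximal_ideals A. a \<notin> M}" by blast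
    have "Max_map A B h -` U \<inter> topspace (Max_obj B) = {N \<in> maximal_ideals B. h a \<notin> N}"
      unfolding U B.topspace_Max_obj using Max_map_maximal a by (auto simp: Max_map_def)
    then show "openin (Max_obj B) (Max_map A B h -` U \<inter> topspace (Max_obj B))"
      using B.openin_Max_obj_basic[OF GA_hom_closed[OF a]] by simp
  qed
  then show ?thesis by (simp add: KH_hom_def Max_map_def B.topspace_Max_obj)
qed

lemma gelfand_transform_natural:
  "GA_comp A (C_map (Max_obj B) (Max_obj A) (Max_map A B h)) (gelfand_transform A) =
     GA_comp A (gelfand_transform B) h"
proof
  fix a
  show "GA_comp A (C_map (Max_obj B) (Max_obj A) (Max_map A B h)) (gelfand_transform A) a =
     GA_comp A (gelfand_transform B) h a"
  proof (cases "a \<in> carrier A")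
    case True
    have "C_map (Max_obj B) (Max_obj A) (Max_map A B h) (gelfand_transform A a) = gelfand_transform B (h a)"
      unfolding C_map_apply[OF A.gelfand_transform_closed[OF True]]
      using True GA_hom_closed Max_map_maximal residue_value_Max_map
      by (auto simp: gelfand_transform_def B.topspace_Max_obj)
    then show ?thesis using True by (simp add: GA_comp_def compose_def)
  qed (simp add: GA_comp_def compose_def)
qed

end

lemma Max_map_comp:
  fixes A :: "('f::topological_field, 'a) module" and B :: "('f, 'b) module" and D :: "('f, 'd) module"
  assumes A: "GA_obj A" and B: "GA_obj B" and D: "GA_obj D"
    and h: "h \<in> GA_hom A B" and k: "k \<in> GA_hom B D"
  shows "Max_map A D (GA_comp A k h) = KH_comp (Max_obj D) (Max_map A B h) (Max_map B D k)"
proof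
  interpret D: gelfand_algebra D by (rule gelfand_algebra.intro[OF D])
  fix L
  show "Max_map A D (GA_comp A k h) L = KH_comp (Max_obj D) (Max_map A B h) (Max_map B D k) L"
  proof (cases "L \<in> maximal_ideals D")
    case True
    have "Max_map A B h (Max_map B D k L) = {a \<in> carrier A. k (h a) \<in> L}"
      using Max_map_maximal[OF B D k True] True GA_hom_closed[OF A B h] by (auto simp: Max_map_def)
    then show ?thesis
      using True by (auto simp: Max_map_def[of A D] KH_comp_def GA_comp_def compose_def D.topspace_Max_obj)
  qed (simp add: Max_map_def[of A D] KH_comp_def compose_def D.topspace_Max_obj)
qed

lemma Max_map_id:
  fixes A :: "('f::topological_field, 'a) module"
  assumes A: "GA_obj A"
  shows "Max_map A A (GA_id A) = KH_id (Max_obj A)"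
proof -
  interpret gelfand_algebra A by (rule gelfand_algebra.intro[OF A])
  have "{a \<in> carrier A. GA_id A a \<in> M} = M" if "M \<in> maximal_ideals A" for M
    using ideal.Icarr[OF maximal_ideal_ideal[OF that]] by (auto simp: GA_id_def)
  then show ?thesis unfolding Max_map_def KH_id_def topspace_Max_obj by (rule restrict_ext)
qed

lemma point_ideal_iso:
  fixes S :: "'x topology"
  assumes complete: "complete_field TYPE('f::topological_field)"
    and sw: "stone_weierstrass TYPE('f) TYPE('x)" and S: "KH_obj TYPE('f) S"
  shows "point_ideal S \<in> KH_iso S (Max_obj (C_obj S :: ('f, 'x \<Rightarrow> 'f) module))"
proof -
  let ?A = "C_obj S :: ('f, 'x \<Rightarrow> 'f) module"
  interpret gelfand_algebra ?A by (rule gelfand_algebra.intro[OF GA_obj_C_obj[OF sw S complete]])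
  have Tych: "F_Tychonoff TYPE('f) S" and cpt: "compact_space S"
    using S by (simp_all add: KH_obj_def)
  have Haus: "Hausdorff_space (Max_obj ?A)"
    using KH_obj_Max_obj[OF GA_obj] Hausdorff_F_Tychonoff by (auto simp: KH_obj_def)
  have cont: "continuous_map S (Max_obj ?A) (point_ideal S)"
    unfolding Max_obj_def
  proof (rule continuous_on_generated_topo)
    show "point_ideal S ` topspace S \<subseteq> \<Union>{{M \<in> maximal_ideals ?A. f \<notin> M} | f. f \<in> carrier ?A}"
      using point_ideal_maximal topspace_Max_obj
      unfolding Max_obj_def topology_generated_by_topspace by auto
    fix U assume "U \<in> {{M \<in> maximal_ideals ?A. f \<notin> M} | f. f \<in> carrier ?A}"
    then obtain f where f: "f \<in> carrier ?A" and U: "U = {M \<in> maximal_ideals ?A. f \<notin> M}" by blast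
    have "point_ideal S -` U \<inter> topspace S = {x \<in> topspace S. f x \<in> - {0}}"
      using f point_ideal_maximal[of _ S] by (auto simp: U point_ideal_def)
    also have "openin S \<dots>"
      using C_obj_continuous[OF f] closed_singleton_field[of "0::'f"]
      by (intro openin_continuous_map_preimage[of _ euclidean]) (simp_all add: closed_def)
    finally show "openin S (point_ideal S -` U \<inter> topspace S)" .
  qed
  have "inj_on (point_ideal S :: 'x \<Rightarrow> ('x \<Rightarrow> 'f) set) (topspace S)"
  proof (rule inj_onI, rule ccontr)
    fix x y assume xy: "x \<in> topspace S" "y \<in> topspace S" "x \<noteq> y"
      and eq: "(point_ideal S x :: ('x \<Rightarrow> 'f) set) = point_ideal S y"
    have "closedin S {y}" using closedin_Hausdorff_singleton[OF Hausdorff_F_Tychonoff[OF Tych] xy(2)] .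
    then obtain f :: "'x \<Rightarrow> 'f" where "f \<in> carrier ?A" "f x = 1" "f y = 0"
      using F_Tychonoff_separates[OF Tych _ xy(1), of "{y}"] xy(3) by blast
    then have "f \<in> point_ideal S y" "f \<notin> point_ideal S x" using xy by (auto simp: point_ideal_def)
    with eq show False by simp
  qed
  then have "homeomorphic_map S (Max_obj ?A) (point_ideal S)"
    using continuous_imp_homeomorphic_map[OF cont cpt Haus]
    by (simp add: topspace_Max_obj maximal_ideals_C_obj[OF sw S])
  then show ?thesis using cont by (simp add: KH_iso_def KH_hom_def point_ideal_def)
qed

lemma point_ideal_natural:
  fixes S :: "'x topology" and T :: "'y topology"
  assumes f: "f \<in> KH_hom S T"
  shows "KH_comp S (Max_map (C_obj T :: ('f::topological_field, 'y \<Rightarrow> 'f) module) (C_obj S) (C_map S T f)) (point_ideal S) =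
    KH_comp S (point_ideal T) f"
proof
  let ?A = "C_obj T :: ('f, 'y \<Rightarrow> 'f) module" and ?B = "C_obj S :: ('f, 'x \<Rightarrow> 'f) module"
  fix x
  show "KH_comp S (Max_map ?A ?B (C_map S T f)) (point_ideal S) x = KH_comp S (point_ideal T) f x"
  proof (cases "x \<in> topspace S")
    case True
    have "(point_ideal S x :: ('x \<Rightarrow> 'f) set) \<in> maximal_ideals ?B"
      by (rule point_ideal_maximal[OF True])
    then have "Max_map ?A ?B (C_map S T f) (point_ideal S x) = {g \<in> carrier ?A. C_map S T f g \<in> point_ideal S x}"
      by (simp add: Max_map_def)
    also have "\<dots> = point_ideal T (f x)"
      using True KH_hom_maps[OF f True] C_map_closed[OF f]
      by (auto simp: point_ideal_def C_map_apply)
    finally show ?thesis using True by (simp add: KH_comp_def compose_def)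
  qed (simp add: KH_comp_def compose_def)
qed

theorem theorem34:
  assumes "complete_field TYPE('f::topological_field)"
    and "stone_weierstrass TYPE('f) TYPE('x)"
    and "stone_weierstrass TYPE('f) TYPE('a set)"
  shows "
    \<comment> \<open>continuous functions form a contravariant functor\<close>
    (\<forall>S :: 'x topology. KH_obj TYPE('f) S \<longrightarrow>
       GA_obj (C_obj S :: ('f, 'x \<Rightarrow> 'f) module)) \<and>
    (\<forall>(S :: 'x topology) (T :: 'y topology) f.
       KH_obj TYPE('f) S \<and> KH_obj TYPE('f) T \<and> f \<in> KH_hom S T \<longrightarrow>
       C_map S T f \<in> GA_hom (C_obj T :: ('f, 'y \<Rightarrow> 'f) module) (C_obj S)) \<and>
    (\<forall>S :: 'x topology. KH_obj TYPE('f) S \<longrightarrow>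
       C_map S S (KH_id S) = GA_id (C_obj S :: ('f, 'x \<Rightarrow> 'f) module)) \<and>
    (\<forall>(S :: 'x topology) (T :: 'y topology) (W :: 'z topology) f g.
       KH_obj TYPE('f) S \<and> KH_obj TYPE('f) T \<and> KH_obj TYPE('f) W \<and>
       f \<in> KH_hom S T \<and> g \<in> KH_hom T W \<longrightarrow>
       C_map S W (KH_comp S g f) =
         GA_comp (C_obj W :: ('f, 'z \<Rightarrow> 'f) module) (C_map S T f) (C_map T W g)) \<and>

    \<comment> \<open>maximal ideals form a contravariant functor\<close>
    (\<forall>A :: ('f, 'a) module. GA_obj A \<longrightarrow> KH_obj TYPE('f) (Max_obj A)) \<and>
    (\<forall>(A :: ('f, 'a) module) (B :: ('f, 'b) module) h.
       GA_obj A \<and> GA_obj B \<and> h \<in> GA_hom A B \<longrightarrow>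
       Max_map A B h \<in> KH_hom (Max_obj B) (Max_obj A)) \<and>
    (\<forall>A :: ('f, 'a) module. GA_obj A \<longrightarrow>
       Max_map A A (GA_id A) = KH_id (Max_obj A)) \<and>
    (\<forall>(A :: ('f, 'a) module) (B :: ('f, 'b) module) (D :: ('f, 'd) module) h k.
       GA_obj A \<and> GA_obj B \<and> GA_obj D \<and> h \<in> GA_hom A B \<and> k \<in> GA_hom B D \<longrightarrow>
       Max_map A D (GA_comp A k h) =
         KH_comp (Max_obj D) (Max_map A B h) (Max_map B D k)) \<and>

    \<comment> \<open>natural isomorphism from the identity of spaces\<close>
    (\<forall>S :: 'x topology. KH_obj TYPE('f) S \<longrightarrow>
       point_ideal S \<in> KH_iso S (Max_obj (C_obj S :: ('f, 'x \<Rightarrow> 'f) module))) \<and>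
    (\<forall>(S :: 'x topology) (T :: 'y topology) f.
       KH_obj TYPE('f) S \<and> KH_obj TYPE('f) T \<and> f \<in> KH_hom S T \<longrightarrow>
       KH_comp S (Max_map (C_obj T :: ('f, 'y \<Rightarrow> 'f) module) (C_obj S) (C_map S T f)) (point_ideal S) =
         KH_comp S (point_ideal T) f) \<and>

    \<comment> \<open>natural isomorphism from the identity of algebras\<close>
    (\<forall>A :: ('f, 'a) module. GA_obj A \<longrightarrow>
       gelfand_transform A \<in> GA_iso A (C_obj (Max_obj A))) \<and>
    (\<forall>(A :: ('f, 'a) module) (B :: ('f, 'b) module) h.
       GA_obj A \<and> GA_obj B \<and> h \<in> GA_hom A B \<longrightarrow>
       GA_comp A (C_map (Max_obj B) (Max_obj A) (Max_map A B h)) (gelfand_transform A) =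
         GA_comp A (gelfand_transform B) h)"
  using assms
  by (intro conjI allI impI; (elim conjE)?)
    (simp_all add: GA_obj_C_obj C_map_hom C_map_id C_map_comp KH_obj_Max_obj Max_map_hom Max_map_id
      Max_map_comp point_ideal_iso point_ideal_natural
      gelfand_algebra.gelfand_transform_iso gelfand_algebra.intro gelfand_transform_natural)

end
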